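(* Let $X,Y$ be Banach spaces, $T$ an arbitrary index set, $g_t:X\to(-\infty,\infty]$ ($t\in T$) and $h:X\to Y$, let $\Omega:=\{x\in X : h(x)=0,\ g_t(x)\le 0 \text{ for all } t\in T\}$ and $\bar x\in\Omega$, and let the standing assumptions (SA) hold at $\bar x$. Let the functions $g_t$, $t\in T$, be uniformly Fréchet differentiable at $\bar x$, and let the system $\{g_t(x)\le 0\ (t\in T),\ h(x)=0\}$ satisfy the PMFCQ and NFMCQ conditions at $\bar x$. Then $$\widehat N(\bar x;\Omega)=\mathrm{cone}\{\nabla g_t(\bar x): t\in T(\bar x)\}+\nabla h(\bar x)^*(Y^* ).$$ If in addition the functions $g_t$, $t\in T$, are uniformly strictly differentiable at $\bar x$, then $$N(\bar x;\Omega)=\mathrm{cone}\{\nabla g_t(\bar x): t\in T(\bar x)\}+\nabla h(\bar x)^*(Y^* ).$$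
   Context: $X^*,Y^*$ are the topological duals, $\langle\cdot,\cdot\rangle$ is the canonical pairing, $\mathbb B_r(x)$ is the closed ball of radius $r$ centered at $x$. For a set $S$, $\mathrm{cone}\,S$ is the convex cone generated by $S\cup\{0\}$. $\nabla h(\bar x)^*:Y^*\to X^*$ is the adjoint of $\nabla h(\bar x)$. Standing assumptions (SA) at $\bar x$: each $g_t$, $t\in T$, is Fréchet differentiable at $\bar x$; the set $\{\nabla g_t(\bar x): t\in T\}$ is bounded in $X^*$; $h$ is strictly differentiable at $\bar x$, i.e. there is a continuous linear operator $\nabla h(\bar x):X\to Y$ with $\lim_{x,x'\to\bar x}\frac{h(x)-h(x')-\nabla h(\bar x)(x-x')}{\|x-x'\|}=0$. Uniform Fréchet differentiability of $\{g_t\}_{t\in T}$ at $\bar x$: $s(\eta):=\sup_{t\in T}\sup_{x\in \mathbb B_\eta(\bar x),\,x\ne\bar x}\frac{|g_t(x)-g_t(\bar x)-\langle\nabla g_t(\bar x),x-\bar x\rangle|}{\|x-\bar x\|}\to0$ as $\eta\downarrow0$. Uniform strict differentiability of $\{g_t\}_{t\in T}$ at $\bar x$: $r(\eta):=\sup_{t\in T}\sup_{x,x'\in \mathbb B_\eta(\bar x),\,x\ne x'}\frac{|g_t(x)-g_t(x')-\langle\nabla g_t(\bar x),x-x'\rangle|}{\|x-x'\|}\to0$ as $\eta\downarrow0$. $T(\bar x):=\{t\in T: g_t(\bar x)=0\}$ and $T_\varepsilon(\bar x):=\{t\in T: g_t(\bar x)\ge-\varepsilon\}$. PMFCQ at $\bar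 x$: $\nabla h(\bar x)$ is surjective and there is $\tilde x\in X$ with $\nabla h(\bar x)\tilde x=0$ and $\inf_{\varepsilon>0}\sup_{t\in T_\varepsilon(\bar x)}\langle\nabla g_t(\bar x),\tilde x\rangle<0$ (with $\sup\emptyset=-\infty$). NFMCQ (Nonlinear Farkas-Minkowski Constraint Qualification) at $\bar x$: the set $\mathrm{cone}\{(\nabla g_t(\bar x),\langle\nabla g_t(\bar x),\bar x\rangle-g_t(\bar x)): t\in T\}$ is weak$^*$ closed in $X^*\times\mathbb R$. For $\varphi:X\to(-\infty,\infty]$, $\bar x\in\mathrm{dom}\,\varphi$ and $\varepsilon\ge0$, $\widehat\partial_\varepsilon\varphi(\bar x):=\{x^*\in X^*:\liminf_{x\to\bar x}\frac{\varphi(x)-\varphi(\bar x)-\langle x^*,x-\bar x\rangle}{\|x-\bar x\|}\ge-\varepsilon\}$, and $\widehat\partial_\varepsilon\varphi(\bar x):=\emptyset$ if $\varphi(\bar x)=\infty$; $\widehat\partial\varphi:=\widehat\partial_0\varphi$. The limiting subdifferential $\partial\varphi(\bar x)$ is the set of $x^*\in X^*$ for which there exist sequences $x_n\to\bar x$ with $\varphi(x_n)\to\varphi(\bar x)$, $\varepsilon_n\downarrow0$ and $x_n^*\in\widehat\partial_{\varepsilon_n}\varphi(x_n)$ with $x_n^*\to x^*$ weak$^*$. With $\delta(x;\Omega)=0$ for $x\in\Omega$ and $\infty$ otherwise, $\widehat N(\bar x;\Omega):=\widehat\partial\delta(\bar x;\Omega)$ (Fréchet normal cone) and $N(\bar x;\Omega):=\partial\delta(\bar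 x;\Omega)$ (limiting normal cone). *)

theory Defs
  imports "HOL-Analysis.Analysis"
begin

text \<open>
  The topological dual of \<open>'a\<close> is \<open>'a \<Rightarrow>\<^sub>L real\<close> with the operator norm.  For scalar-valued operators
  the strong operator topology is the topology of pointwise convergence, i.e. the weak* topology.
\<close>

abbreviation weak_star_topology :: "('a::real_normed_vector \<Rightarrow>\<^sub>L real) topology" where
  "weak_star_topology \<equiv> strong_operator_topology"

definition dual_adjoint ::
    "('a::real_normed_vector \<Rightarrow>\<^sub>L 'b::real_normed_vector) \<Rightarrow> ('b \<Rightarrow>\<^sub>L real) \<Rightarrow> ('a \<Rightarrow>\<^sub>L real)" where
  "dual_adjoint A = (\<lambda>y. y o\<^sub>L A)"

definition cone_gen :: "'a::real_vector set \<Rightarrow> 'a set" where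
  "cone_gen S = convex_cone hull (insert 0 S)"


subsection \<open>Differentiability\<close>

text \<open>Differentiability of an extended-real-valued function at a point includes finiteness near it.\<close>

definition has_frechet_derivative_ereal ::
    "('a::real_normed_vector \<Rightarrow> ereal) \<Rightarrow> ('a \<Rightarrow>\<^sub>L real) \<Rightarrow> 'a \<Rightarrow> bool" where
  "has_frechet_derivative_ereal f A x \<longleftrightarrow>
     (\<forall>\<^sub>F y in nhds x. \<bar>f y\<bar> \<noteq> \<infinity>) \<and>
     ((\<lambda>y. real_of_ereal (f y)) has_derivative blinfun_apply A) (at x)"

definition has_strict_derivative ::
    "('a::real_normed_vector \<Rightarrow> 'b::real_normed_vector) \<Rightarrow> ('a \<Rightarrow>\<^sub>L 'b) \<Rightarrow> 'a \<Rightarrow> bool" where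
  "has_strict_derivative h A x \<longleftrightarrow>
     ((\<lambda>(u, v). (h u - h v - A (u - v)) /\<^sub>R norm (u - v)) \<longlongrightarrow> 0)
       (at (x, x) within {(u, v). u \<noteq> v})"

text \<open>
  The moduli below are suprema of nonnegative quantities, hence taken in \<open>[0, \<infinity>]\<close>; the outer \<open>max 0\<close>
  makes the supremum of the empty family \<open>0\<close> (instead of \<open>-\<infinity>\<close>).  In \<open>strict_modulus\<close>, if both
  values of \<open>g t\<close> are \<open>\<infinity>\<close>, their difference is \<open>\<infinity>\<close> by the conventions of \<^typ>\<open>ereal\<close>, so such
  a pair makes the modulus \<open>\<infinity>\<close> rather than passing unnoticed.
\<close>

definition frechet_modulus ::
    "'i set \<Rightarrow> ('i \<Rightarrow> 'a::real_normed_vector \<Rightarrow> ereal) \<Rightarrow> ('i \<Rightarrow> 'a \<Rightarrow>\<^sub>L real) \<Rightarrow> 'a \<Rightarrow> real \<Rightarrow> ereal" where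
  "frechet_modulus T g G xb \<eta> =
     max 0 (SUP t\<in>T. SUP x\<in>cball xb \<eta> - {xb}.
       \<bar>g t x - g t xb - ereal (G t (x - xb))\<bar> / ereal (norm (x - xb)))"

definition strict_modulus ::
    "'i set \<Rightarrow> ('i \<Rightarrow> 'a::real_normed_vector \<Rightarrow> ereal) \<Rightarrow> ('i \<Rightarrow> 'a \<Rightarrow>\<^sub>L real) \<Rightarrow> 'a \<Rightarrow> real \<Rightarrow> ereal" where
  "strict_modulus T g G xb \<eta> =
     max 0 (SUP t\<in>T. SUP (x, x')\<in>{(x, x'). x \<in> cball xb \<eta> \<and> x' \<in> cball xb \<eta> \<and> x \<noteq> x'}.
       \<bar>g t x - g t x' - ereal (G t (x - x'))\<bar> / ereal (norm (x - x')))"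

definition uniformly_frechet_diff ::
    "'i set \<Rightarrow> ('i \<Rightarrow> 'a::real_normed_vector \<Rightarrow> ereal) \<Rightarrow> ('i \<Rightarrow> 'a \<Rightarrow>\<^sub>L real) \<Rightarrow> 'a \<Rightarrow> bool" where
  "uniformly_frechet_diff T g G xb \<longleftrightarrow> (frechet_modulus T g G xb \<longlongrightarrow> 0) (at_right 0)"

definition uniformly_strictly_diff ::
    "'i set \<Rightarrow> ('i \<Rightarrow> 'a::real_normed_vector \<Rightarrow> ereal) \<Rightarrow> ('i \<Rightarrow> 'a \<Rightarrow>\<^sub>L real) \<Rightarrow> 'a \<Rightarrow> bool" where
  "uniformly_strictly_diff T g G xb \<longleftrightarrow> (strict_modulus T g G xb \<longlongrightarrow> 0) (at_right 0)"


subsection \<open>The constraint system and its qualification conditions\<close>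

definition feasible_set ::
    "'i set \<Rightarrow> ('i \<Rightarrow> 'a \<Rightarrow> ereal) \<Rightarrow> ('a \<Rightarrow> 'b::zero) \<Rightarrow> 'a set" where
  "feasible_set T g h = {x. h x = 0 \<and> (\<forall>t\<in>T. g t x \<le> 0)}"

definition active :: "'i set \<Rightarrow> ('i \<Rightarrow> 'a \<Rightarrow> ereal) \<Rightarrow> 'a \<Rightarrow> 'i set" where
  "active T g x = {t \<in> T. g t x = 0}"

definition eps_active :: "'i set \<Rightarrow> ('i \<Rightarrow> 'a \<Rightarrow> ereal) \<Rightarrow> 'a \<Rightarrow> real \<Rightarrow> 'i set" where
  "eps_active T g x \<epsilon> = {t \<in> T. g t x \<ge> - ereal \<epsilon>}"

text \<open>
  In the next two definitions \<open>G t\<close> and \<open>H\<close> are the derivatives of \<open>g t\<close> and \<open>h\<close> at \<open>xb\<close>.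
\<close>

definition PMFCQ ::
    "'i set \<Rightarrow> ('i \<Rightarrow> 'a::real_normed_vector \<Rightarrow> ereal) \<Rightarrow> ('i \<Rightarrow> 'a \<Rightarrow>\<^sub>L real) \<Rightarrow>
     ('a \<Rightarrow>\<^sub>L 'b::real_normed_vector) \<Rightarrow> 'a \<Rightarrow> bool" where
  "PMFCQ T g G H xb \<longleftrightarrow>
     surj (blinfun_apply H) \<and>
     (\<exists>d. blinfun_apply H d = 0 \<and> (INF \<epsilon>\<in>{0<..}. SUP t\<in>eps_active T g xb \<epsilon>. ereal (G t d)) < 0)"

definition NFMCQ ::
    "'i set \<Rightarrow> ('i \<Rightarrow> 'a::real_normed_vector \<Rightarrow> ereal) \<Rightarrow> ('i \<Rightarrow> 'a \<Rightarrow>\<^sub>L real) \<Rightarrow> 'a \<Rightarrow> bool" where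
  "NFMCQ T g G xb \<longleftrightarrow>
     closedin (prod_topology weak_star_topology euclideanreal)
       (cone_gen ((\<lambda>t. (G t, G t xb - real_of_ereal (g t xb))) ` T))"


subsection \<open>Subdifferentials and normal cones\<close>

definition frechet_subdiff_eps ::
    "real \<Rightarrow> ('a::real_normed_vector \<Rightarrow> ereal) \<Rightarrow> 'a \<Rightarrow> ('a \<Rightarrow>\<^sub>L real) set" where
  "frechet_subdiff_eps \<epsilon> \<phi> xb =
     (if \<phi> xb = \<infinity> then {}
      else {xs. Liminf (at xb)
                  (\<lambda>x. (\<phi> x - \<phi> xb - ereal (blinfun_apply xs (x - xb))) / ereal (norm (x - xb)))
                \<ge> - ereal \<epsilon>})"

definition frechet_subdiff :: "('a::real_normed_vector \<Rightarrow> ereal) \<Rightarrow> 'a \<Rightarrow> ('a \<Rightarrow>\<^sub>L real) set" where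
  "frechet_subdiff = frechet_subdiff_eps 0"

definition limiting_subdiff :: "('a::real_normed_vector \<Rightarrow> ereal) \<Rightarrow> 'a \<Rightarrow> ('a \<Rightarrow>\<^sub>L real) set" where
  "limiting_subdiff \<phi> xb =
     {xs. \<exists>x \<epsilon> xsn.
        x \<longlonglongrightarrow> xb \<and> (\<lambda>n. \<phi> (x n)) \<longlonglongrightarrow> \<phi> xb \<and>
        (\<forall>n::nat. \<epsilon> n \<ge> 0) \<and> \<epsilon> \<longlonglongrightarrow> 0 \<and>
        (\<forall>n. xsn n \<in> frechet_subdiff_eps (\<epsilon> n) \<phi> (x n)) \<and>
        limitin weak_star_topology xsn xs sequentially}"

definition indicator_ereal :: "'a set \<Rightarrow> 'a \<Rightarrow> ereal" where
  "indicator_ereal \<Omega> x = (if x \<in> \<Omega> then 0 else \<infinity>)"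

definition frechet_normal_cone :: "'a::real_normed_vector \<Rightarrow> 'a set \<Rightarrow> ('a \<Rightarrow>\<^sub>L real) set" where
  "frechet_normal_cone xb \<Omega> = frechet_subdiff (indicator_ereal \<Omega>) xb"

definition limiting_normal_cone :: "'a::real_normed_vector \<Rightarrow> 'a set \<Rightarrow> ('a \<Rightarrow>\<^sub>L real) set" where
  "limiting_normal_cone xb \<Omega> = limiting_subdiff (indicator_ereal \<Omega>) xb"

end

theory Submission
  imports Defs
begin

text \<open>
  Write \<open>c t\<close> for the value of \<open>g t\<close> at \<open>xb\<close>.  The theorem compares normals with multipliers through the
  linearized system \<open>H u = 0\<close>, \<open>G t u + c t \<le> 0\<close> for all \<open>t\<close>.

  That every multiplier combination is a Frechet normal is a first-order expansion along feasible points
  (\<open>multiplier_cone_subset_frechet_normal_cone\<close>), and Frechet normals are limiting normals.  So both equalities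
  reduce to one inclusion: a normal belongs to the multiplier cone.  Its proof has two halves.

  Analysis: a Frechet normal, or a weak* limit of approximate normals at nearby feasible points, is nonpositive
  on every solution \<open>u\<close> of the linearized system (\<open>limit_of_normals_nonpos\<close>).  The solution is pushed
  slightly in the Mangasarian-Fromovitz direction \<open>d\<close>, which gives all nearly active inequalities a uniform
  margin.  A short step in the pushed direction then violates only \<open>h = 0\<close>, and surjectivity of \<open>H\<close> with
  strict differentiability of \<open>h\<close> repairs this by a much shorter correction (\<open>Lyusternik_Graves\<close>).  Testing
  the normals at the resulting feasible points gives the claim; uniformity in \<open>t\<close> is what makes one step size
  work for infinitely many constraints, and Banach-Steinhaus bounds the approximate normals.

  Duality: a functional that is nonpositive on the solutions of the linearized system is a multiplier
  combination.  This is a Farkas lemma (\<open>Farkas_closed_cone\<close>), in which the Farkas-Minkowski condition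
  provides a weak* closed cone.  The direction \<open>d\<close> provides a linear functional on this cone that controls
  the norm, so the cone has weak* compact slices.  Compactness allows restricting
  to the kernel of \<open>H\<close> without losing closedness, and reduces separation to the plane.  The inhomogeneous term
  forces complementary slackness (\<open>cone_gen_active_part\<close>), so that only active indices remain.
  Finally, functionals that agree on the kernel of \<open>H\<close> differ by an element of the range of the adjoint
  (\<open>annihilator_kernel\<close>).
\<close>

section \<open>Consequences of the Baire category theorem\<close>

lemma Baire_closed_cover:
  fixes C :: "nat \<Rightarrow> 'a::banach set"
  assumes "\<And>n. closed (C n)" and "(\<Union>n. C n) = UNIV"
  obtains n x r where "r > 0" "cball x r \<subseteq> C n"
proof -
  have "\<exists>n. interior (C n) \<noteq> {}"
  proof (rule ccontr)
    assume "\<not> ?thesis"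
    then have "Met_TC.mtopology interior_of \<Union>(range C) = {}"
      by (intro Met_TC.metric_Baire_category_alt)
         (use assms in \<open>auto simp: mcomplete_iff_complete complete_UNIV\<close>)
    then show False
      using assms(2) by simp
  qed
  then obtain n x where "x \<in> interior (C n)" by blast
  then show ?thesis
    using that by (meson mem_interior_cball)
qed

text \<open>
  By Baire, one of the closed sets on which all \<open>f n\<close> are bounded by a fixed \<open>k\<close> contains a ball;
  differences of points of that ball with its centre then bound the operator norms.  Its use here: a
  weak* convergent sequence of normals is norm bounded.
\<close>

lemma uniform_boundedness_sequence:
  fixes f :: "nat \<Rightarrow> 'a::banach \<Rightarrow>\<^sub>L 'b::real_normed_vector"
  assumes bdd: "\<And>x. bounded (range (\<lambda>n. f n x))"
  obtains M where "\<And>n. norm (f n) \<le> M"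
proof -
  define C where "C k = {x. \<forall>n. norm (f n x) \<le> real k}" for k
  have clo: "closed (C k)" for k
  proof -
    have "C k = (\<Inter>n. {x. norm (f n x) \<le> real k})"
      by (auto simp: C_def)
    moreover have "closed {x. norm (f n x) \<le> real k}" for n
      by (intro closed_Collect_le continuous_intros)
    ultimately show ?thesis by auto
  qed
  have "x \<in> (\<Union>k. C k)" for x
  proof -
    obtain M where M: "\<And>n. norm (f n x) \<le> M"
      using bdd[of x] by (auto simp: bounded_iff)
    have "x \<in> C (nat \<lceil>M\<rceil>)"
      unfolding C_def using M by (auto intro: order_trans[OF _ real_nat_ceiling_ge])
    then show ?thesis by blast
  qed
  then have "(\<Union>k. C k) = UNIV" by blast
  with clo obtain k x r where r: "r > 0" "cball x r \<subseteq> C k"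
    by (rule Baire_closed_cover)
  have "norm (f n) \<le> 2 * real k / r" for n
  proof (rule norm_blinfun_bound)
    show "0 \<le> 2 * real k / r" using r by simp
    fix v
    show "norm (f n v) \<le> 2 * real k / r * norm v"
    proof (cases "v = 0")
      case False
      define w where "w = (r / norm v) *\<^sub>R v"
      have nw: "norm w = r" using False r by (simp add: w_def)
      have "x + w \<in> C k" "x \<in> C k" using r nw by (auto simp: dist_norm)
      then have "norm (f n (x + w)) \<le> k" "norm (f n x) \<le> k" by (auto simp: C_def)
      moreover have "f n w = f n (x + w) - f n x" by (simp add: blinfun.bilinear_simps)
      ultimately have "norm (f n w) \<le> 2 * k"
        using norm_triangle_ineq4[of "f n (x + w)" "f n x"] by simp
      then show ?thesis
        using False r by (simp add: w_def blinfun.bilinear_simps field_simps)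
    qed auto
  qed
  then show ?thesis using that by blast
qed

text \<open>
  This is the half of the open mapping theorem that Baire's theorem gives directly: the closure of the
  image of some ball contains a ball, so equations \<open>A x = y\<close> can be solved up to a fixed fraction of
  \<open>y\<close> by an \<open>x\<close> of controlled size.  The Newton iteration below absorbs the residual.
\<close>

lemma surj_approx_right_inverse:
  fixes A :: "'a::real_normed_vector \<Rightarrow>\<^sub>L 'b::banach"
  assumes "surj A"
  obtains c where "c > 0" "\<And>y. \<exists>x. norm x \<le> c * norm y \<and> norm (y - A x) \<le> norm y / 4"
proof -
  define C where "C k = closure (A ` cball 0 (real k))" for k
  have "(\<Union>k. C k) = UNIV"
  proof -
    have "y \<in> (\<Union>k. C k)" for y
    proof -
      obtain x where "y = A x" using assms by (metis surjD)
      moreover have "x \<in> cball 0 (real (nat \<lceil>norm x\<rceil>))" using real_nat_ceiling_ge by auto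
      ultimately have "y \<in> C (nat \<lceil>norm x\<rceil>)"
        unfolding C_def by (meson closure_subset image_eqI subsetD)
      then show ?thesis by blast
    qed
    then show ?thesis by blast
  qed
  moreover have "\<And>k. closed (C k)" by (simp add: C_def)
  ultimately obtain k y0 r where r: "r > 0" "cball y0 r \<subseteq> C k"
    using Baire_closed_cover by metis
  define c where "c = 2 * real k / r + 1"
  have "\<exists>x. norm x \<le> c * norm y \<and> norm (y - A x) \<le> norm y / 4" for y
  proof (cases "y = 0")
    case False
    define s where "s = r / norm y"
    have s: "s > 0" using False r by (simp add: s_def)
    have "y0 + s *\<^sub>R y \<in> C k" "y0 \<in> C k"
      using r False by (auto simp: dist_norm s_def)
    moreover have "r / 8 > 0" using r by simp
    ultimately have "\<exists>u\<in>cball 0 (real k). dist (A u) (y0 + s *\<^sub>R y) < r / 8"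
      and "\<exists>v\<in>cball 0 (real k). dist (A v) y0 < r / 8"
      unfolding C_def closure_approachable by blast+
    then obtain u v where u: "norm u \<le> k" "dist (A u) (y0 + s *\<^sub>R y) < r / 8"
      and v: "norm v \<le> k" "dist (A v) y0 < r / 8"
      by auto
    define x where "x = (u - v) /\<^sub>R s"
    have nx: "norm x \<le> c * norm y"
    proof -
      have "norm (u - v) \<le> 2 * k" using u v norm_triangle_ineq4[of u v] by linarith
      moreover have "norm x = norm (u - v) / s"
        using s by (simp add: x_def divide_inverse mult.commute)
      ultimately have "norm x \<le> (2 * k) / s"
        using s by (simp add: divide_right_mono)
      also have "\<dots> = (2 * real k / r) * norm y" by (simp add: s_def)
      also have "\<dots> \<le> c * norm y" by (intro mult_right_mono) (auto simp: c_def)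
      finally show ?thesis .
    qed
    have "s *\<^sub>R (y - A x) = (y0 + s *\<^sub>R y - A u) - (y0 - A v)"
      using s by (simp add: x_def blinfun.bilinear_simps algebra_simps)
    then have "norm (s *\<^sub>R (y - A x)) \<le> r / 8 + r / 8"
      using u v norm_triangle_ineq4[of "y0 + s *\<^sub>R y - A u" "y0 - A v"]
      by (simp add: dist_norm norm_minus_commute)
    then have "s * norm (y - A x) \<le> r / 4"
      using s unfolding norm_scaleR by simp
    then have "norm (y - A x) \<le> (r / 4) / s"
      using s by (simp add: pos_le_divide_eq mult.commute)
    then have "norm (y - A x) \<le> norm y / 4" using r by (simp add: s_def)
    with nx show ?thesis by blast
  qed auto
  moreover have "c > 0" using r by (auto simp: c_def intro!: add_nonneg_pos)
  ultimately show ?thesis using that by blast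
qed

section \<open>Solving equations near a point of strict differentiability\<close>

text \<open>
  Newton's iteration \<open>x\<^bsub>n+1\<^esub> = x\<^bsub>n\<^esub> + R (- h x\<^bsub>n\<^esub>)\<close> with an approximate right inverse \<open>R\<close> of \<open>A\<close>: each step
  halves \<open>norm (h x\<^bsub>n\<^esub>)\<close>, one quarter being lost to the linearization error of \<open>h\<close> and one quarter to
  the residual of \<open>R\<close>.  The steps therefore form a geometric series of total length at most
  \<open>2 * c * norm (h x0)\<close>, which keeps the iterates in the ball where the linearization is controlled and
  makes them converge to a zero of \<open>h\<close>.
\<close>

lemma Lyusternik_Graves:
  fixes h :: "'a::banach \<Rightarrow> 'b::real_normed_vector" and A :: "'a \<Rightarrow>\<^sub>L 'b"
  assumes c: "c > 0" and inv: "\<And>y. \<exists>x. norm x \<le> c * norm y \<and> norm (y - A x) \<le> norm y / 4"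
    and lip: "\<And>u v. u \<in> cball x0 r \<Longrightarrow> v \<in> cball x0 r \<Longrightarrow>
                norm (h u - h v - A (u - v)) \<le> norm (u - v) / (4 * c)"
    and r: "2 * c * norm (h x0) \<le> r"
  obtains z where "norm (z - x0) \<le> 2 * c * norm (h x0)" "h z = 0"
proof -
  obtain R where R: "\<And>y. norm (R y) \<le> c * norm y" "\<And>y. norm (y - A (R y)) \<le> norm y / 4"
    using inv by metis
  define m where "m = norm (h x0)"
  \<comment> \<open>The iterates; the bound on the distance below is the partial sum of the geometric series.\<close>
  define x where "x n = ((\<lambda>v. v + R (- h v)) ^^ n) x0" for n
  have x0: "x 0 = x0" and xS: "x (Suc n) = x n + R (- h (x n))" for n
    by (simp_all add: x_def)
  have main: "norm (h (x n)) \<le> m / 2^n \<and> norm (x n - x0) \<le> 2 * c * m * (1 - 1 / 2^n)" for n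
  proof (induction n)
    case 0
    show ?case by (simp add: x0 m_def)
  next
    case (Suc n)
    have step: "norm (x (Suc n) - x n) \<le> c * norm (h (x n))"
      using R(1)[of "- h (x n)"] by (simp add: xS)
    also have "\<dots> \<le> c * (m / 2^n)" using Suc c by (intro mult_left_mono) auto
    finally have step': "norm (x (Suc n) - x n) \<le> c * (m / 2^n)" .
    have d: "norm (x (Suc n) - x0) \<le> 2 * c * m * (1 - 1 / 2^Suc n)"
    proof -
      have "norm (x (Suc n) - x0) \<le> norm (x (Suc n) - x n) + norm (x n - x0)"
        using norm_triangle_ineq[of "x (Suc n) - x n" "x n - x0"] by simp
      also have "\<dots> \<le> c * (m / 2^n) + 2 * c * m * (1 - 1 / 2^n)" using step' Suc by linarith
      also have "\<dots> = 2 * c * m * (1 - 1 / 2^Suc n)" by (simp add: field_simps)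
      finally show ?thesis .
    qed
    have le: "2 * c * m * (1 - 1 / 2^k) \<le> r" for k :: nat
    proof -
      have "2 * c * m * (1 - 1 / 2^k) \<le> 2 * c * m * 1"
        using c by (intro mult_left_mono) (auto simp: m_def)
      then show ?thesis using r by (simp add: m_def)
    qed
    have inb: "x (Suc n) \<in> cball x0 r" "x n \<in> cball x0 r"
      using d Suc le[of "Suc n"] le[of n] by (auto simp: dist_norm norm_minus_commute)
    have "h (x (Suc n)) = (h (x (Suc n)) - h (x n) - A (x (Suc n) - x n)) - (- h (x n) - A (R (- h (x n))))"
      by (simp add: xS)
    then have "norm (h (x (Suc n))) \<le> norm (h (x (Suc n)) - h (x n) - A (x (Suc n) - x n)) + norm (- h (x n) - A (R (- h (x n))))"
      by (metis norm_triangle_ineq4)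
    also have "\<dots> \<le> norm (x (Suc n) - x n) / (4 * c) + norm (h (x n)) / 4"
      using lip[OF inb] R(2)[of "- h (x n)"] by simp
    also have "\<dots> \<le> norm (h (x n)) / 4 + norm (h (x n)) / 4"
      using step c by (simp add: field_simps)
    also have "\<dots> \<le> m / 2 ^ Suc n" using Suc by (simp add: field_simps)
    finally show ?case using d by blast
  qed
  have step': "norm (x (Suc n) - x n) \<le> c * m * (1 / 2)^n" for n
  proof -
    have "norm (x (Suc n) - x n) \<le> c * norm (h (x n))"
      using R(1)[of "- h (x n)"] by (simp add: xS)
    also have "\<dots> \<le> c * (m / 2^n)" using main[of n] c by (intro mult_left_mono) auto
    finally show ?thesis by (simp add: power_divide)
  qed
  have "summable (\<lambda>n. x (Suc n) - x n)"
    by (rule summable_comparison_test'[where g = "\<lambda>n. c * m * (1/2)^n" and N = 0])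
       (use step' in \<open>auto intro!: summable_mult summable_geometric\<close>)
  then have "convergent (\<lambda>n. \<Sum>i<n. x (Suc i) - x i)"
    by (simp add: summable_iff_convergent)
  then have "convergent (\<lambda>n. x n - x 0)"
    by (simp add: sum_lessThan_telescope)
  then obtain l where "(\<lambda>n. x n - x 0) \<longlonglongrightarrow> l" by (auto simp: convergent_def)
  then have "(\<lambda>n. x n - x 0 + x 0) \<longlonglongrightarrow> l + x 0" by (intro tendsto_add) auto
  then obtain z where z: "x \<longlonglongrightarrow> z" by auto
  have near: "norm (x n - x0) \<le> 2 * c * m" for n
  proof -
    have "2 * c * m * (1 - 1 / 2^n) \<le> 2 * c * m * 1"
      using c by (intro mult_left_mono) (auto simp: m_def)
    then show ?thesis using main[of n] by simp
  qed
  have nz: "norm (z - x0) \<le> 2 * c * m"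
    by (rule Lim_norm_ubound[of sequentially "\<lambda>n. x n - x0"])
       (use near z in \<open>auto intro!: tendsto_diff\<close>)
  have hz: "(\<lambda>n. h (x n)) \<longlonglongrightarrow> h z"
  proof -
    have "(\<lambda>n. norm (x n - z) / (4 * c) + norm (A (x n - z))) \<longlonglongrightarrow> norm (z - z) / (4 * c) + norm (A (z - z))"
      using c by (intro tendsto_intros z) auto
    then have "(\<lambda>n. norm (x n - z) / (4 * c) + norm (A (x n - z))) \<longlonglongrightarrow> 0"
      by (simp add: blinfun.bilinear_simps)
    moreover have "norm (h (x n) - h z) \<le> norm (x n - z) / (4 * c) + norm (A (x n - z))" for n
    proof -
      have "norm (h (x n) - h z - A (x n - z)) \<le> norm (x n - z) / (4 * c)"
        using near[of n] nz r by (intro lip) (auto simp: dist_norm norm_minus_commute m_def)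
      then show ?thesis
        using norm_triangle_sub[of "h (x n) - h z" "A (x n - z)"] by linarith
    qed
    ultimately have "(\<lambda>n. h (x n) - h z) \<longlonglongrightarrow> 0"
      by (intro Lim_null_comparison[of "\<lambda>n. h (x n) - h z"]) auto
    then show ?thesis by (rule LIM_zero_cancel)
  qed
  have "(\<lambda>n. m * (1 / 2)^n) \<longlonglongrightarrow> m * 0"
    by (intro tendsto_mult LIMSEQ_power_zero) auto
  then have "(\<lambda>n. h (x n)) \<longlonglongrightarrow> 0"
    using main by (intro Lim_null_comparison[of "\<lambda>n. h (x n)" "\<lambda>n. m * (1 / 2)^n"]) (auto simp: power_divide)
  with hz have "h z = 0" using LIMSEQ_unique by blast
  with nz that show ?thesis by (simp add: m_def)
qed

text \<open>
  The open mapping theorem: \<open>x \<mapsto> A x - y\<close> is its own linearization, so the Newton iteration started at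
  \<open>0\<close> reaches an exact solution.
\<close>

lemma surj_bounded_right_inverse:
  fixes A :: "'a::banach \<Rightarrow>\<^sub>L 'b::banach"
  assumes "surj A"
  obtains c where "c > 0" "\<And>y. \<exists>x. norm x \<le> c * norm y \<and> A x = y"
proof -
  obtain c where c: "c > 0" and inv: "\<And>y. \<exists>x. norm x \<le> c * norm y \<and> norm (y - A x) \<le> norm y / 4"
    using surj_approx_right_inverse[OF assms] by metis
  have "\<exists>x. norm x \<le> (2 * c) * norm y \<and> A x = y" for y
  proof -
    obtain z where "norm (z - 0) \<le> 2 * c * norm (A 0 - y)" "A z - y = 0"
      by (rule Lyusternik_Graves[OF c inv, of 0 "2 * c * norm (A 0 - y)" "\<lambda>x. A x - y"])
         (use c in \<open>auto simp: blinfun.bilinear_simps\<close>)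
    then show ?thesis by (auto simp: blinfun.bilinear_simps)
  qed
  then show ?thesis using that[of "2 * c"] c by auto
qed

text \<open>
  A functional vanishing on the kernel of \<open>A\<close> factors through \<open>A\<close>, and the factor is bounded by the open
  mapping theorem.  This is what turns an identity of functionals on the kernel of the derivative of the
  equality constraint into an identity modulo the range of its adjoint.
\<close>

lemma annihilator_kernel:
  fixes A :: "'a::banach \<Rightarrow>\<^sub>L 'b::banach" and f :: "'a \<Rightarrow>\<^sub>L real"
  assumes "surj A" and ker: "\<And>v. A v = 0 \<Longrightarrow> f v = 0"
  shows "f \<in> range (dual_adjoint A)"
proof -
  obtain c where c: "c > 0" "\<And>y. \<exists>x. norm x \<le> c * norm y \<and> A x = y"
    using surj_bounded_right_inverse[OF assms(1)] by metis
  obtain R where R: "\<And>y. norm (R y) \<le> c * norm y" "\<And>y. A (R y) = y"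
    using c(2) by metis
  have eq: "f u = f v" if "A u = A v" for u v
    using ker[of "u - v"] that by (simp add: blinfun.bilinear_simps)
  have "bounded_linear (\<lambda>y. f (R y))"
  proof (rule bounded_linear_intro[where K = "norm f * c"])
    show "f (R (x + y)) = f (R x) + f (R y)" for x y
      unfolding blinfun.add_right[symmetric] by (rule eq) (simp add: R blinfun.bilinear_simps)
    show "f (R (a *\<^sub>R x)) = a *\<^sub>R f (R x)" for a x
      unfolding blinfun.scaleR_right[symmetric] by (rule eq) (simp add: R blinfun.bilinear_simps)
    show "norm (f (R x)) \<le> norm x * (norm f * c)" for x
    proof -
      have "norm (f (R x)) \<le> norm f * norm (R x)" by (rule norm_blinfun)
      also have "\<dots> \<le> norm f * (c * norm x)" by (intro mult_left_mono R) auto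
      finally show ?thesis by (simp add: ac_simps)
    qed
  qed
  then have "f = dual_adjoint A (Blinfun (\<lambda>y. f (R y)))"
    by (intro blinfun_eqI) (auto simp: dual_adjoint_def bounded_linear_Blinfun_apply R intro: eq)
  then show ?thesis by blast
qed

section \<open>Generated cones and weak* compactness\<close>

lemma convex_cone_cone_gen: "convex_cone (cone_gen S)"
  by (simp add: cone_gen_def convex_cone_convex_cone_hull)

lemma cone_gen_superset: "S \<subseteq> cone_gen S"
  unfolding cone_gen_def by (meson hull_subset insert_subset)

lemma cone_gen_minimal:
  assumes "convex_cone C" "S \<subseteq> C"
  shows "cone_gen S \<subseteq> C"
  unfolding cone_gen_def by (rule hull_minimal) (use assms convex_cone_contains_0 in auto)

text \<open>
  The dual ball is the set of linear functions in a product of compact intervals; this set is closed in the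
  topology of pointwise convergence, hence compact by Tychonoff's theorem.
\<close>

lemma Banach_Alaoglu:
  "compactin weak_star_topology {f :: 'a::real_normed_vector \<Rightarrow>\<^sub>L real. norm f \<le> M}"
proof (cases "M \<ge> 0")
  case False
  then have "{f :: 'a \<Rightarrow>\<^sub>L real. norm f \<le> M} = {}"
    using order_trans[OF norm_ge_zero] by blast
  then show ?thesis by simp
next
  case True
  define S where "S = {\<phi> :: 'a \<Rightarrow> real. linear \<phi> \<and> (\<forall>x. \<bar>\<phi> x\<bar> \<le> M * norm x)}"
  have S_eq: "S = (\<Pi>\<^sub>E x\<in>UNIV. {- (M * norm x)..M * norm x}) \<inter>
      ((\<Inter>x y. {\<phi>. \<phi> (x + y) = \<phi> x + \<phi> y}) \<inter> (\<Inter>c x. {\<phi>. \<phi> (c *\<^sub>R x) = c *\<^sub>R \<phi> x}))"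
    by (auto simp: S_def linear_iff abs_le_iff PiE_iff minus_le_iff)
  have "compactin (product_topology (\<lambda>i. euclidean) UNIV) (\<Pi>\<^sub>E x\<in>UNIV. {- (M * norm x)..M * norm x})"
    unfolding compactin_PiE by auto
  then have "compact (\<Pi>\<^sub>E x\<in>(UNIV::'a set). {- (M * norm x)..M * norm x})"
    by (simp add: euclidean_product_topology)
  moreover have "closed ((\<Inter>x y. {\<phi> :: 'a \<Rightarrow> real. \<phi> (x + y) = \<phi> x + \<phi> y}) \<inter> (\<Inter>c x. {\<phi>. \<phi> (c *\<^sub>R x) = c *\<^sub>R \<phi> x}))"
    by (intro closed_Int closed_INT ballI closed_Collect_eq continuous_intros continuous_on_product_coordinates)
  ultimately have "compact S"
    unfolding S_eq by (rule compact_Int_closed)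
  have bl: "bounded_linear \<phi>" if "\<phi> \<in> S" for \<phi>
  proof -
    have "linear \<phi>" and b: "\<And>x. norm (\<phi> x) \<le> norm x * M" using that by (auto simp: S_def mult.commute)
    then show ?thesis
      using bounded_linear.intro[of \<phi>] bounded_linear_axioms.intro by blast
  qed
  have "continuous_map (top_of_set S) weak_star_topology Blinfun"
    unfolding continuous_on_strong_operator_topo_iff_coordinatewise
  proof
    fix x
    show "continuous_map (top_of_set S) euclideanreal (\<lambda>\<phi>. blinfun_apply (Blinfun \<phi>) x)"
      by (rule continuous_map_eq[where f = "\<lambda>\<phi>. \<phi> x"])
        (auto simp: bl bounded_linear_Blinfun_apply
          intro!: continuous_on_subset[OF continuous_on_product_coordinates])
  qed
  then have "compactin weak_star_topology (Blinfun ` S)"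
    by (rule image_compactin[rotated]) (use \<open>compact S\<close> in \<open>simp add: compactin_subtopology\<close>)
  moreover have "Blinfun ` S = {f. norm f \<le> M}"
  proof (intro equalityI subsetI)
    fix f assume "f \<in> Blinfun ` S"
    then show "f \<in> {f. norm f \<le> M}"
      using True by (auto intro!: norm_blinfun_bound simp: bl bounded_linear_Blinfun_apply) (auto simp: S_def)
  next
    fix f :: "'a \<Rightarrow>\<^sub>L real" assume f: "f \<in> {f. norm f \<le> M}"
    have "\<bar>f x\<bar> \<le> M * norm x" for x
      using norm_blinfun[of f x] f mult_right_mono[of "norm f" M "norm x"] by auto
    then have "blinfun_apply f \<in> S"
      by (auto simp: S_def blinfun.bilinear_simps intro!: linearI)
    then show "f \<in> Blinfun ` S"
      by (metis blinfun_apply_inverse image_eqI)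
  qed
  ultimately show ?thesis by simp
qed

section \<open>A Farkas lemma for weak* closed cones with a compact base\<close>

text \<open>
  Induction on \<open>F\<close>: prescribing the value at one more point \<open>w\<close> cuts \<open>B\<close> down to a slice \<open>B0\<close>, and
  the slice inherits the hypothesis.  For if it failed at \<open>z\<close>, the image of \<open>B\<close> under the
  evaluations at \<open>z\<close> and \<open>w\<close> would be a compact convex set in the plane that misses the prescribed
  point, and the separating line would be a combination of \<open>z\<close> and \<open>w\<close> violating the hypothesis for
  \<open>B\<close>.
\<close>

lemma convex_compact_evaluation_finite:
  fixes p :: "'k::real_vector \<Rightarrow> 'z::real_vector \<Rightarrow> real"
  assumes lin1: "\<And>z. linear (\<lambda>k. p k z)" and lin2: "\<And>k. linear (p k)" and linf: "linear f"
    and cont: "\<And>z. continuous_map \<tau> euclideanreal (\<lambda>k. p k z)"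
    and Z: "subspace Z" and F: "finite F" "F \<subseteq> Z"
    and B: "compactin \<tau> B" "convex B" "\<And>z. z \<in> Z \<Longrightarrow> \<exists>k\<in>B. f z \<le> p k z"
  shows "\<exists>k\<in>B. \<forall>z\<in>F. p k z = f z"
  using F B
proof (induction F arbitrary: B rule: finite_induct)
  case empty
  then show ?case using subspace_0[OF Z] by blast
next
  case (insert w F)
  define B0 where "B0 = {k \<in> B. p k w = f w}"
  have "compactin \<tau> B0"
  proof -
    have "closedin \<tau> {k \<in> topspace \<tau>. p k w \<in> {f w}}"
      by (rule closedin_continuous_map_preimage[OF cont]) auto
    then have "compactin \<tau> ({k \<in> topspace \<tau>. p k w \<in> {f w}} \<inter> B)"
      using insert.prems by (intro closed_Int_compactin)
    moreover have "{k \<in> topspace \<tau>. p k w \<in> {f w}} \<inter> B = B0"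
      using compactin_subset_topspace[OF insert.prems(2)] by (auto simp: B0_def)
    ultimately show ?thesis by simp
  qed
  moreover have "convex B0"
  proof -
    have "B0 = B \<inter> (\<lambda>k. p k w) -` {f w}" by (auto simp: B0_def)
    then show ?thesis
      using insert.prems by (auto intro!: convex_Int convex_linear_vimage lin1)
  qed
  moreover have "\<exists>k\<in>B0. f z \<le> p k z" if z: "z \<in> Z" for z
  proof (rule ccontr)
    assume none: "\<not> ?thesis"
    define D where "D = (\<lambda>k. (p k z - f z, p k w - f w)) ` B"
    have D_eq: "D = (\<lambda>q. (- f z, - f w) + q) ` (\<lambda>k. (p k z, p k w)) ` B"
      by (auto simp: D_def image_image)
    have "linear (\<lambda>k. (p k z, p k w))"
      using lin1 by (auto simp: linear_iff)
    then have "convex D"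
      unfolding D_eq using insert.prems by (intro convex_translation convex_linear_image)
    have "continuous_map \<tau> (prod_topology euclideanreal euclideanreal) (\<lambda>k. (p k z, p k w))"
      using cont by (intro continuous_map_pairedI)
    then have "compact ((\<lambda>k. (p k z, p k w)) ` B)"
      using image_compactin[OF insert.prems(2), of euclidean "\<lambda>k. (p k z, p k w)"] by simp
    then have "closed D"
      unfolding D_eq by (intro compact_imp_closed compact_translation)
    have "0 \<notin> D"
      using none by (force simp: D_def B0_def zero_prod_def)
    with \<open>convex D\<close> \<open>closed D\<close> obtain a b where ab: "0 < b" "\<forall>x\<in>D. inner a x > b"
      using separating_hyperplane_closed_0 by blast
    obtain \<alpha> \<beta> where a: "a = (\<alpha>, \<beta>)" by fastforce
    define y where "y = (- \<alpha>) *\<^sub>R z + (- \<beta>) *\<^sub>R w"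
    have "y \<in> Z"
      unfolding y_def using z insert.prems(1) by (intro subspace_add[OF Z] subspace_scale[OF Z]) auto
    then obtain k where k: "k \<in> B" "f y \<le> p k y" using insert.prems by blast
    have "\<alpha> * (p k z - f z) + \<beta> * (p k w - f w) > b"
      using ab(2) k(1) by (auto simp: D_def a)
    moreover have "p k y = - \<alpha> * p k z - \<beta> * p k w" "f y = - \<alpha> * f z - \<beta> * f w"
      using lin2[of k] linf by (simp_all add: y_def linear_add linear_scale linear_diff linear_neg)
    ultimately show False using k(2) ab(1) by (simp add: algebra_simps)
  qed
  ultimately obtain k where "k \<in> B0" "\<forall>z\<in>F. p k z = f z"
    using insert.IH[of B0] insert.prems(1) by blast
  then show ?case by (auto simp: B0_def)
qed

text \<open>
  Compactness of \<open>B\<close> passes from finitely many evaluation points to all of them: a functional dominated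
  by the support function of a compact convex set of functionals belongs to that set, as far as points of
  \<open>Z\<close> can tell.
\<close>

lemma convex_compact_evaluation:
  fixes p :: "'k::real_vector \<Rightarrow> 'z::real_vector \<Rightarrow> real"
  assumes lin1: "\<And>z. linear (\<lambda>k. p k z)" and lin2: "\<And>k. linear (p k)" and linf: "linear f"
    and cont: "\<And>z. continuous_map \<tau> euclideanreal (\<lambda>k. p k z)"
    and Z: "subspace Z"
    and B: "compactin \<tau> B" "convex B" "\<And>z. z \<in> Z \<Longrightarrow> \<exists>k\<in>B. f z \<le> p k z"
  shows "\<exists>k\<in>B. \<forall>z\<in>Z. p k z = f z"
proof -
  define C where "C z = {k \<in> topspace \<tau>. p k z \<in> {f z}}" for z
  have "B \<inter> \<Inter>(C ` Z) \<noteq> {}"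
  proof (rule compactin_fip[THEN iffD1, OF B(1), THEN conjunct2, rule_format], intro conjI ballI allI impI)
    fix S assume "S \<in> C ` Z"
    then obtain z where "S = C z" by blast
    then show "closedin \<tau> S"
      unfolding C_def by (simp only:, intro closedin_continuous_map_preimage[OF cont]) auto
  next
    fix \<F> assume "finite \<F> \<and> \<F> \<subseteq> C ` Z"
    then obtain F where F: "finite F" "F \<subseteq> Z" "\<F> = C ` F"
      by (meson finite_subset_image)
    have "\<exists>k\<in>B. \<forall>z\<in>F. p k z = f z"
      by (rule convex_compact_evaluation_finite[OF lin1 lin2 linf cont Z F(1,2) B])
    then show "B \<inter> \<Inter>\<F> \<noteq> {}"
      using compactin_subset_topspace[OF B(1)] by (auto simp: F(3) C_def)
  qed
  then show ?thesis by (auto simp: C_def)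
qed

text \<open>
  The quantity \<open>r - k xb\<close> is additive on pairs \<open>(k, r)\<close> and equals \<open>- c t \<ge> 0\<close> on the generators.  It can
  only vanish on a combination if every generator used has \<open>c t = 0\<close>: complementary slackness.
\<close>

lemma cone_gen_active_part:
  fixes a :: "'i \<Rightarrow> 'a::real_normed_vector \<Rightarrow>\<^sub>L real" and k :: "'a \<Rightarrow>\<^sub>L real"
  assumes c: "\<And>t. t \<in> T \<Longrightarrow> c t \<le> (0::real)"
    and k: "(k, k xb) \<in> cone_gen ((\<lambda>t. (a t, a t xb - c t)) ` T)"
  shows "k \<in> cone_gen (a ` {t \<in> T. c t = 0})"
proof -
  let ?A = "cone_gen (a ` {t \<in> T. c t = 0})"
  note cc = convex_cone_cone_gen[of "a ` {t \<in> T. c t = 0}"]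
  define C where "C = {(k, r). r \<ge> blinfun_apply k xb \<and> (r = k xb \<longrightarrow> k \<in> ?A)}"
  have "convex_cone C"
    unfolding convex_cone_iff
  proof (intro conjI ballI allI impI)
    show "0 \<in> C"
      using convex_cone_contains_0[OF cc] by (auto simp: C_def zero_prod_def)
  next
    fix x y assume xy: "x \<in> C" "y \<in> C"
    obtain k r k' r' where kr: "x = (k, r)" "y = (k', r')" by fastforce
    have "k \<in> ?A \<and> k' \<in> ?A" if "r + r' = k xb + k' xb"
      using xy that by (auto simp: C_def kr)
    then show "x + y \<in> C"
      using xy convex_cone_add[OF cc] by (auto simp: C_def kr blinfun.add_left)
  next
    fix x and s :: real assume x: "x \<in> C" and s: "0 \<le> s"
    obtain k r where kr: "x = (k, r)" by fastforce
    show "s *\<^sub>R x \<in> C"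
    proof (cases "s = 0")
      case True
      then show ?thesis using convex_cone_contains_0[OF cc] by (auto simp: C_def zero_prod_def)
    next
      case False
      then show ?thesis
        using x s convex_cone_scaleR[OF cc] by (auto simp: C_def kr blinfun.scaleR_left mult_left_mono)
    qed
  qed
  moreover have "(\<lambda>t. (a t, a t xb - c t)) ` T \<subseteq> C"
    using c cone_gen_superset[of "a ` {t \<in> T. c t = 0}"] by (auto simp: C_def)
  ultimately have "(k, k xb) \<in> C"
    using cone_gen_minimal k by blast
  then show ?thesis by (simp add: C_def)
qed

text \<open>
  With the pairing \<open>p (k, r) (u, s) = k u + s * (r - k xb)\<close>, the system \<open>a t u + c t \<le> 0\<close> says that all
  generators are nonpositive at \<open>(u, -1)\<close>.  The Slater direction \<open>d\<close> gives a point \<open>e = (d, - m)\<close> at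
  which all generators are negative, in proportion to their size.  So \<open>p k e\<close> controls the norm on
  the whole cone, and the slice \<open>B\<close> of elements with \<open>p k e = f d\<close> is weak* compact by Alaoglu's
  theorem.  The hypothesis on \<open>f\<close> makes \<open>f\<close> dominated by the support function of \<open>B\<close>, so some
  element of \<open>B\<close> agrees with \<open>f\<close> on \<open>N\<close> and satisfies \<open>r = k xb\<close>.

  Restriction to \<open>N\<close> corresponds to adding the annihilator of \<open>N\<close> to the cone, and sums of closed cones
  need not be closed; the compact slices are what keeps the restricted cone closed.
\<close>

lemma Farkas_closed_cone:
  fixes a :: "'i \<Rightarrow> 'a::real_normed_vector \<Rightarrow>\<^sub>L real" and c :: "'i \<Rightarrow> real" and xb d :: 'a
    and \<epsilon> \<delta> M :: real and f :: "'a \<Rightarrow>\<^sub>L real"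
  assumes K: "closedin (prod_topology weak_star_topology euclideanreal)
                (cone_gen ((\<lambda>t. (a t, a t xb - c t)) ` T))"
    and c: "\<And>t. t \<in> T \<Longrightarrow> c t \<le> 0" and M: "\<And>t. t \<in> T \<Longrightarrow> norm (a t) \<le> M"
    and N: "subspace N" and d: "d \<in> N" and eps: "\<epsilon> > 0" and del: "\<delta> > 0"
    and slater: "\<And>t. t \<in> T \<Longrightarrow> c t \<ge> - \<epsilon> \<Longrightarrow> a t d \<le> - \<delta>"
    and cons: "\<And>u. u \<in> N \<Longrightarrow> (\<And>t. t \<in> T \<Longrightarrow> a t u + c t \<le> 0) \<Longrightarrow> f u \<le> 0"
  shows "\<exists>k \<in> cone_gen (a ` {t \<in> T. c t = 0}). \<forall>u\<in>N. blinfun_apply k u = f u"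
proof -
  define K' where "K' = cone_gen ((\<lambda>t. (a t, a t xb - c t)) ` T)"
  define gen where "gen t = (a t, a t xb - c t)" for t
  define p where "p k z = blinfun_apply (fst k) (fst z) + snd z * (snd k - blinfun_apply (fst k) xb)"
    for k :: "('a \<Rightarrow>\<^sub>L real) \<times> real" and z :: "'a \<times> real"
  note cc = convex_cone_cone_gen[of "(\<lambda>t. (a t, a t xb - c t)) ` T", folded K'_def]
  have genK: "gen t \<in> K'" if "t \<in> T" for t
    unfolding K'_def gen_def by (rule subsetD[OF cone_gen_superset]) (use that in blast)
  have p_gen: "p (gen t) (u, s) = a t u - s * c t" for t u s
    by (simp add: p_def gen_def)
  have lin1: "linear (\<lambda>k. p k z)" for z
    by (auto simp: p_def linear_iff blinfun.bilinear_simps algebra_simps)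
  have lin2: "linear (p k)" for k
    by (auto simp: p_def linear_iff blinfun.bilinear_simps algebra_simps)
  note lin_simps = linear_add[OF lin1] linear_scale[OF lin1] linear_add[OF lin2] linear_scale[OF lin2]
  define Md where "Md = \<bar>M\<bar>"
  have Md: "norm (a t) \<le> Md" if "t \<in> T" for t using M[OF that] by (simp add: Md_def)
  have Md0: "Md \<ge> 0" by (simp add: Md_def)
  \<comment> \<open>The first summand handles the indices with \<open>c t \<ge> - \<epsilon>\<close>, where \<open>d\<close> itself gives \<open>- \<delta>\<close>; the second one the
    remaining indices, where \<open>- m\<close> multiplies \<open>- c t > \<epsilon>\<close>.  The factor \<open>1 - c t\<close> in the next estimate is
    essential, because \<open>c\<close> need not be bounded below.\<close>
  define m where "m = \<delta> + (Md * norm d + \<delta>) / \<epsilon>"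
  define e where "e = (d, - m)"
  have pe: "p (gen t) e \<le> - \<delta> * (1 - c t)" if t: "t \<in> T" for t
  proof (cases "c t \<ge> - \<epsilon>")
    case True
    have "m \<ge> \<delta>" using eps del Md0 by (simp add: m_def)
    then have "m * c t \<le> \<delta> * c t" using c[OF t] by (simp add: mult_right_mono_neg)
    with slater[OF t True] show ?thesis by (simp add: e_def p_gen algebra_simps)
  next
    case False
    have "\<bar>a t d\<bar> \<le> norm (a t) * norm d" using norm_blinfun[of "a t" d] by simp
    also have "\<dots> \<le> Md * norm d" using Md[OF t] by (intro mult_right_mono) auto
    finally have 1: "a t d \<le> Md * norm d" by simp
    have "(Md * norm d + \<delta>) / \<epsilon> * c t \<le> (Md * norm d + \<delta>) / \<epsilon> * (- \<epsilon>)"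
      using False eps del Md0 by (intro mult_left_mono) auto
    also have "\<dots> = - (Md * norm d + \<delta>)" using eps by simp
    finally show ?thesis using 1 by (simp add: e_def p_gen m_def algebra_simps)
  qed
  have pe0: "p (gen t) e < 0" if t: "t \<in> T" for t
  proof -
    have "\<delta> * (1 - c t) > 0" using c[OF t] del by (intro mult_pos_pos) auto
    then show ?thesis using pe[OF t] by simp
  qed
  have weight: "1 - c t \<le> - p (gen t) e / \<delta>" if t: "t \<in> T" for t
    using pe[OF t] del by (simp add: field_simps)
  have bounds: "norm (fst k) \<le> Md / \<delta> * (- p k e) \<and> \<bar>snd k - blinfun_apply (fst k) xb\<bar> \<le> 1 / \<delta> * (- p k e)"
    if "k \<in> K'" for k
  proof -
    define C where "C = {k. norm (fst k) \<le> Md / \<delta> * (- p k e) \<and> \<bar>snd k - blinfun_apply (fst k) xb\<bar> \<le> 1 / \<delta> * (- p k e)}"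
    have "convex_cone C"
      unfolding convex_cone_iff
    proof (intro conjI ballI allI impI)
      show "0 \<in> C" by (auto simp: C_def p_def)
    next
      fix x y assume x: "x \<in> C" and y: "y \<in> C"
      have "norm (fst (x + y)) \<le> norm (fst x) + norm (fst y)" by (simp add: norm_triangle_ineq)
      also have "\<dots> \<le> Md / \<delta> * (- p (x + y) e)"
        using x y by (simp add: C_def lin_simps algebra_simps)
      finally have "norm (fst (x + y)) \<le> Md / \<delta> * (- p (x + y) e)" .
      moreover have "\<bar>snd (x + y) - blinfun_apply (fst (x + y)) xb\<bar> \<le> 1 / \<delta> * (- p (x + y) e)"
        using x y by (auto simp: C_def lin_simps blinfun.bilinear_simps diff_divide_distrib abs_le_iff)
      ultimately show "x + y \<in> C" by (simp add: C_def)
    next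
      fix x and s :: real assume x: "x \<in> C" and s: "0 \<le> s"
      have "norm (fst (s *\<^sub>R x)) = s * norm (fst x)" using s by simp
      also have "\<dots> \<le> s * (Md / \<delta> * (- p x e))" using x s by (intro mult_left_mono) (auto simp: C_def)
      finally have 1: "norm (fst (s *\<^sub>R x)) \<le> Md / \<delta> * (- p (s *\<^sub>R x) e)"
        by (simp add: lin_simps mult.left_commute)
      have "\<bar>snd (s *\<^sub>R x) - blinfun_apply (fst (s *\<^sub>R x)) xb\<bar> = s * \<bar>snd x - blinfun_apply (fst x) xb\<bar>"
        using s by (simp add: blinfun.bilinear_simps abs_mult right_diff_distrib[symmetric])
      also have "\<dots> \<le> s * (1 / \<delta> * (- p x e))" using x s by (intro mult_left_mono) (auto simp: C_def)
      finally show "s *\<^sub>R x \<in> C" using 1 by (simp add: C_def lin_simps)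
    qed
    moreover have "gen t \<in> C" if t: "t \<in> T" for t
    proof -
      have "Md * 1 \<le> Md * (1 - c t)" using c[OF t] Md0 by (intro mult_left_mono) auto
      also have "\<dots> \<le> Md * (- p (gen t) e / \<delta>)" using weight[OF t] Md0 by (intro mult_left_mono) auto
      finally have "norm (a t) \<le> Md * (- p (gen t) e / \<delta>)" using Md[OF t] by simp
      moreover have "\<bar>c t\<bar> \<le> - p (gen t) e / \<delta>" using weight[OF t] c[OF t] by simp
      ultimately show ?thesis by (simp add: C_def gen_def)
    qed
    ultimately have "K' \<subseteq> C"
      unfolding K'_def gen_def by (intro cone_gen_minimal) auto
    then show ?thesis using that by (auto simp: C_def)
  qed
  \<comment> \<open>The hypothesis on \<open>f\<close> in homogeneous form, for an arbitrary second component \<open>s\<close>: dividing by a large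
    \<open>l\<close> makes the second component at least \<open>-1\<close>, and \<open>c \<le> 0\<close> allows lowering it to \<open>-1\<close>.\<close>
  have key: "f u \<le> 0" if u: "u \<in> N" and le: "\<And>t. t \<in> T \<Longrightarrow> p (gen t) (u, s) \<le> 0" for u s
  proof -
    define l where "l = max (- s) 0 + 1"
    have l: "l > 0" "s + l \<ge> 0" by (auto simp: l_def)
    have "f (u /\<^sub>R l) \<le> 0"
    proof (rule cons)
      show "u /\<^sub>R l \<in> N" using N u by (intro subspace_scale)
      fix t assume t: "t \<in> T"
      have "a t u \<le> s * c t" using le[OF t] by (simp add: p_gen)
      moreover have "(s + l) * c t \<le> 0" using l c[OF t] by (intro mult_nonneg_nonpos)
      ultimately have "a t u + l * c t \<le> 0" by (simp add: algebra_simps)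
      then have "(a t u + l * c t) / l \<le> 0" using l by (intro divide_nonpos_pos)
      then show "a t (u /\<^sub>R l) + c t \<le> 0"
        using l by (simp add: blinfun.bilinear_simps field_simps)
    qed
    then show ?thesis using l by (simp add: blinfun.bilinear_simps divide_le_0_iff field_simps)
  qed
  have fd: "f d \<le> 0"
    by (rule key[of d "- m"]) (use d pe0 in \<open>auto simp: e_def less_imp_le\<close>)
  define B where "B = {k \<in> K'. p k e = f d}"
  let ?\<tau> = "prod_topology weak_star_topology euclideanreal"
  have top: "topspace ?\<tau> = (UNIV :: (('a \<Rightarrow>\<^sub>L real) \<times> real) set)"
    by (simp add: strong_operator_topology_topspace)
  have ev: "continuous_map ?\<tau> euclideanreal (\<lambda>k. blinfun_apply (fst k) u)" for u :: 'a
    using continuous_map_compose[OF continuous_map_fst strong_operator_topology_continuous_evaluation[of u]]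
    by (simp add: o_def)
  have cont: "continuous_map ?\<tau> euclideanreal (\<lambda>k. p k z)" for z
    unfolding p_def by (intro continuous_map_add continuous_map_real_mult continuous_map_diff ev continuous_map_snd) auto
  have "compactin ?\<tau> B"
  proof -
    define R where "R = (1 + Md * norm xb) / \<delta> * (- f d)"
    have "closedin ?\<tau> {k \<in> topspace ?\<tau>. p k e \<in> {f d}}"
      by (intro closedin_continuous_map_preimage[OF cont]) auto
    with K have "closedin ?\<tau> (K' \<inter> {k \<in> topspace ?\<tau>. p k e \<in> {f d}})"
      unfolding K'_def by (rule closedin_Int)
    moreover have "K' \<inter> {k \<in> topspace ?\<tau>. p k e \<in> {f d}} = B"
      unfolding top by (auto simp: B_def)
    moreover have "compactin ?\<tau> ({l. norm l \<le> Md / \<delta> * (- f d)} \<times> {- R..R})"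
      by (simp add: compactin_Times Banach_Alaoglu)
    moreover have "B \<subseteq> {l. norm l \<le> Md / \<delta> * (- f d)} \<times> {- R..R}"
    proof
      fix k assume "k \<in> B"
      then have b: "norm (fst k) \<le> Md / \<delta> * (- f d)" "\<bar>snd k - blinfun_apply (fst k) xb\<bar> \<le> 1 / \<delta> * (- f d)"
        using bounds[of k] by (auto simp: B_def)
      have "\<bar>fst k xb\<bar> \<le> norm (fst k) * norm xb" using norm_blinfun[of "fst k" xb] by simp
      also have "\<dots> \<le> Md / \<delta> * (- f d) * norm xb" using b by (intro mult_right_mono) auto
      finally have "\<bar>snd k\<bar> \<le> 1 / \<delta> * (- f d) + Md / \<delta> * (- f d) * norm xb" using b(2) by linarith
      also have "\<dots> = R" using del by (simp add: R_def field_simps)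
      finally show "k \<in> {l. norm l \<le> Md / \<delta> * (- f d)} \<times> {- R..R}"
        using b(1) by (cases k) (auto simp: abs_le_iff)
    qed
    ultimately show ?thesis using closed_compactin by metis
  qed
  have "convex B"
  proof -
    have "B = K' \<inter> (\<lambda>k. p k e) -` {f d}" by (auto simp: B_def)
    moreover have "convex K'" using cc by (simp add: convex_cone_def)
    ultimately show ?thesis by (auto intro!: convex_Int convex_linear_vimage lin1)
  qed
  have dual: "\<exists>k\<in>B. f u \<le> p k (u, s)" if u: "u \<in> N" for u s
  proof (cases "f d = 0")
    case True
    \<comment> \<open>Here the slice is \<open>{0}\<close>; adding a large multiple of \<open>e\<close> makes every generator nonpositive while \<open>f\<close> does
      not change, since \<open>f d = 0\<close>.\<close>
    define L where "L = Md * norm u + \<bar>s\<bar>"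
    have "f (u + (L / \<delta>) *\<^sub>R d) \<le> 0"
    proof (rule key)
      show "u + (L / \<delta>) *\<^sub>R d \<in> N" using N u d by (intro subspace_add subspace_scale)
      fix t assume t: "t \<in> T"
      have "\<bar>a t u\<bar> \<le> norm (a t) * norm u" using norm_blinfun[of "a t" u] by simp
      also have "\<dots> \<le> Md * norm u" using Md[OF t] by (intro mult_right_mono) auto
      also have "\<dots> \<le> Md * norm u * (1 - c t)"
        using c[OF t] Md0 mult_left_mono[of 1 "1 - c t" "Md * norm u"] by simp
      finally have 1: "a t u \<le> Md * norm u * (1 - c t)" by simp
      have "- (s * c t) \<le> \<bar>s\<bar> * \<bar>c t\<bar>" by (metis abs_ge_minus_self abs_mult)
      also have "\<dots> \<le> \<bar>s\<bar> * (1 - c t)" using c[OF t] by (intro mult_left_mono) auto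
      finally have "p (gen t) (u, s) \<le> L * (1 - c t)"
        using 1 by (simp add: p_gen L_def algebra_simps)
      also have "\<dots> \<le> L * (- p (gen t) e / \<delta>)"
        using weight[OF t] Md0 by (intro mult_left_mono) (auto simp: L_def)
      finally have "p (gen t) ((u, s) + (L / \<delta>) *\<^sub>R e) \<le> 0"
        by (simp add: lin_simps)
      then show "p (gen t) (u + (L / \<delta>) *\<^sub>R d, s + (L / \<delta>) *\<^sub>R (- m)) \<le> 0"
        by (simp add: e_def)
    qed
    then have "f u \<le> 0" using True by (simp add: blinfun.bilinear_simps)
    moreover have "0 \<in> B" using convex_cone_contains_0[OF cc] True by (simp add: B_def p_def)
    ultimately show ?thesis by (intro bexI[of _ 0]) (auto simp: p_def)
  next
    case False
    with fd have fd': "f d < 0" by simp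
    have approx: "\<exists>k\<in>B. f u - \<eta> \<le> p k (u, s)" if \<eta>: "\<eta> > 0" for \<eta>
    proof -
      \<comment> \<open>This \<open>q\<close> raises \<open>f\<close> to \<open>\<eta> > 0\<close>, so some generator must be positive at the shifted point; rescaled into
        \<open>B\<close>, it is almost as large as \<open>f\<close> at the original point.\<close>
      define q where "q = (f u - \<eta>) / (- f d)"
      have "f (u + q *\<^sub>R d) = \<eta>" using fd' by (simp add: q_def blinfun.bilinear_simps field_simps)
      then have "\<not> f (u + q *\<^sub>R d) \<le> 0" using \<eta> by simp
      moreover have "u + q *\<^sub>R d \<in> N" using N u d by (intro subspace_add subspace_scale)
      ultimately obtain t where t: "t \<in> T" "p (gen t) (u + q *\<^sub>R d, s + q *\<^sub>R (- m)) > 0"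
        using key[of "u + q *\<^sub>R d" "s + q *\<^sub>R (- m)"] by force
      then have "p (gen t) ((u, s) + q *\<^sub>R e) > 0" by (simp add: e_def)
      then have pos: "p (gen t) (u, s) + q * p (gen t) e > 0" by (simp add: lin_simps)
      define r where "r = f d / p (gen t) e"
      have r: "r > 0" using fd' pe0[OF t(1)] by (simp add: r_def divide_neg_neg)
      have "r *\<^sub>R gen t \<in> B"
        using convex_cone_scaleR[OF cc _ genK[OF t(1)], of r] r pe0[OF t(1)]
        by (simp add: B_def lin_simps r_def)
      moreover have "p (r *\<^sub>R gen t) (u, s) \<ge> f u - \<eta>"
      proof -
        have "r * (p (gen t) (u, s) + q * p (gen t) e) \<ge> 0" using pos r by simp
        moreover have "r * (q * p (gen t) e) = - (f u - \<eta>)"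
          using pe0[OF t(1)] fd' by (simp add: r_def q_def field_simps)
        ultimately show ?thesis by (simp add: lin_simps distrib_left)
      qed
      ultimately show ?thesis by blast
    qed
    have "compact ((\<lambda>k. p k (u, s)) ` B)"
      using image_compactin[OF \<open>compactin ?\<tau> B\<close> cont] by simp
    moreover have "(\<lambda>k. p k (u, s)) ` B \<noteq> {}" using approx[of 1] by auto
    ultimately obtain k where k: "k \<in> B" "\<And>k'. k' \<in> B \<Longrightarrow> p k' (u, s) \<le> p k (u, s)"
      using compact_attains_sup[of "(\<lambda>k. p k (u, s)) ` B"] by auto
    have "f u \<le> p k (u, s)"
    proof (rule field_le_epsilon)
      fix \<eta> :: real assume "\<eta> > 0"
      then show "f u \<le> p k (u, s) + \<eta>" using approx[of \<eta>] k(2) by force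
    qed
    then show ?thesis using k(1) by blast
  qed
  have "\<exists>k\<in>B. \<forall>z\<in>N \<times> UNIV. p k z = f (fst z)"
  proof (rule convex_compact_evaluation[OF lin1 lin2 _ cont _ \<open>compactin ?\<tau> B\<close> \<open>convex B\<close>])
    show "linear (\<lambda>z. f (fst z))" by (auto simp: linear_iff blinfun.bilinear_simps)
    show "subspace (N \<times> (UNIV :: real set))" using N by (simp add: subspace_Times)
    show "\<exists>k\<in>B. f (fst z) \<le> p k z" if "z \<in> N \<times> UNIV" for z
      using dual[of "fst z" "snd z"] that by auto
  qed
  then obtain k where k: "k \<in> B" "\<And>u s. u \<in> N \<Longrightarrow> p k (u, s) = f u" by force
  have "snd k = fst k xb"
    using k(2)[of 0 1] subspace_0[OF N] by (simp add: p_def)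
  with k(1) have mem: "(fst k, fst k xb) \<in> cone_gen ((\<lambda>t. (a t, a t xb - c t)) ` T)"
    unfolding B_def K'_def by (cases k) auto
  have "fst k \<in> cone_gen (a ` {t \<in> T. c t = 0})"
    by (rule cone_gen_active_part[OF c mem])
  moreover have "\<forall>u\<in>N. blinfun_apply (fst k) u = f u" using k(2)[of _ 0] by (simp add: p_def)
  ultimately show ?thesis by blast
qed

section \<open>Normal cones and moduli in epsilon-delta form\<close>

lemma frechet_subdiff_eps_indicator:
  assumes x: "x \<in> \<Omega>"
  shows "f \<in> frechet_subdiff_eps \<epsilon> (indicator_ereal \<Omega>) x \<longleftrightarrow>
    (\<forall>\<gamma>>0. \<exists>\<rho>>0. \<forall>z\<in>\<Omega>. norm (z - x) < \<rho> \<longrightarrow> f (z - x) \<le> (\<epsilon> + \<gamma>) * norm (z - x))"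
    (is "_ \<longleftrightarrow> ?R")
proof -
  define q where "q z = (indicator_ereal \<Omega> z - indicator_ereal \<Omega> x - ereal (f (z - x))) / ereal (norm (z - x))" for z
  have q_in: "q z = ereal (- f (z - x) / norm (z - x))" if "z \<in> \<Omega>" "z \<noteq> x" for z
    using that x by (simp add: q_def indicator_ereal_def)
  have q_out: "q z = \<infinity>" if "z \<notin> \<Omega>" for z
    using that x by (auto simp: q_def indicator_ereal_def)
  have "f \<in> frechet_subdiff_eps \<epsilon> (indicator_ereal \<Omega>) x \<longleftrightarrow> ereal (- \<epsilon>) \<le> Liminf (at x) q"
    using x by (simp add: frechet_subdiff_eps_def q_def[abs_def] indicator_ereal_def)
  also have "\<dots> \<longleftrightarrow> (\<forall>y<ereal (- \<epsilon>). \<forall>\<^sub>F z in at x. y < q z)"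
    by (rule le_Liminf_iff)
  also have "\<dots> \<longleftrightarrow> ?R"
  proof
    assume L: "\<forall>y<ereal (- \<epsilon>). \<forall>\<^sub>F z in at x. y < q z"
    show ?R
    proof (intro allI impI)
      fix \<gamma> :: real assume "\<gamma> > 0"
      then have "\<forall>\<^sub>F z in at x. ereal (- \<epsilon> - \<gamma>) < q z" using L by simp
      then obtain \<rho> where \<rho>: "\<rho> > 0" "\<And>z. z \<noteq> x \<Longrightarrow> dist z x < \<rho> \<Longrightarrow> ereal (- \<epsilon> - \<gamma>) < q z"
        by (auto simp: eventually_at)
      have "f (z - x) \<le> (\<epsilon> + \<gamma>) * norm (z - x)" if z: "z \<in> \<Omega>" "norm (z - x) < \<rho>" for z
      proof (cases "z = x")
        case False
        then have "- \<epsilon> - \<gamma> < - f (z - x) / norm (z - x)"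
          using \<rho>(2)[of z] z by (simp add: dist_norm q_in)
        then show ?thesis using False by (simp add: field_simps)
      qed simp
      with \<rho>(1) show "\<exists>\<rho>>0. \<forall>z\<in>\<Omega>. norm (z - x) < \<rho> \<longrightarrow> f (z - x) \<le> (\<epsilon> + \<gamma>) * norm (z - x)"
        by blast
    qed
  next
    assume R: ?R
    show "\<forall>y<ereal (- \<epsilon>). \<forall>\<^sub>F z in at x. y < q z"
    proof (intro allI impI)
      fix y assume y: "y < ereal (- \<epsilon>)"
      then obtain y' where y': "y < ereal y'" "ereal y' < ereal (- \<epsilon>)"
        using ereal_dense2 by blast
      then have "- \<epsilon> - y' > 0" by simp
      then obtain \<rho> where \<rho>: "\<rho> > 0"
        "\<And>z. z \<in> \<Omega> \<Longrightarrow> norm (z - x) < \<rho> \<Longrightarrow> f (z - x) \<le> (\<epsilon> + (- \<epsilon> - y')) * norm (z - x)"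
        using R by metis
      have "y < q z" if z: "z \<noteq> x" "dist z x < \<rho>" for z
      proof (cases "z \<in> \<Omega>")
        case True
        have "f (z - x) \<le> - y' * norm (z - x)" using \<rho>(2)[OF True] z by (simp add: dist_norm)
        then have "y' \<le> - f (z - x) / norm (z - x)" using z by (simp add: field_simps)
        then have "ereal y' \<le> q z" using True z by (simp add: q_in)
        then show ?thesis using y' by simp
      next
        case False
        then show ?thesis using y'(1) by (auto simp: q_out)
      qed
      then show "\<forall>\<^sub>F z in at x. y < q z"
        using \<rho>(1) by (auto simp: eventually_at)
    qed
  qed
  finally show ?thesis .
qed

lemma frechet_normal_cone_iff:
  assumes "x \<in> \<Omega>"
  shows "f \<in> frechet_normal_cone x \<Omega> \<longleftrightarrow>
    (\<forall>\<gamma>>0. \<exists>\<rho>>0. \<forall>z\<in>\<Omega>. norm (z - x) < \<rho> \<longrightarrow> f (z - x) \<le> \<gamma> * norm (z - x))"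
  by (simp add: frechet_normal_cone_def frechet_subdiff_def frechet_subdiff_eps_indicator[OF assms])

lemma convex_cone_frechet_normal_cone:
  assumes x: "x \<in> \<Omega>"
  shows "convex_cone (frechet_normal_cone x \<Omega>)"
  unfolding convex_cone_iff
proof (intro conjI ballI allI impI)
  show "0 \<in> frechet_normal_cone x \<Omega>"
    by (auto simp: frechet_normal_cone_iff[OF x] intro: exI[of _ 1])
next
  fix f f' assume f: "f \<in> frechet_normal_cone x \<Omega>" and f': "f' \<in> frechet_normal_cone x \<Omega>"
  show "f + f' \<in> frechet_normal_cone x \<Omega>"
    unfolding frechet_normal_cone_iff[OF x]
  proof (intro allI impI)
    fix \<gamma> :: real assume "\<gamma> > 0"
    then have "\<gamma> / 2 > 0" by simp
    obtain r where r: "r > 0" "\<And>z. z \<in> \<Omega> \<Longrightarrow> norm (z - x) < r \<Longrightarrow> f (z - x) \<le> \<gamma> / 2 * norm (z - x)"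
      using f[unfolded frechet_normal_cone_iff[OF x]] \<open>\<gamma> / 2 > 0\<close> by metis
    obtain r' where r': "r' > 0" "\<And>z. z \<in> \<Omega> \<Longrightarrow> norm (z - x) < r' \<Longrightarrow> f' (z - x) \<le> \<gamma> / 2 * norm (z - x)"
      using f'[unfolded frechet_normal_cone_iff[OF x]] \<open>\<gamma> / 2 > 0\<close> by metis
    have "(f + f') (z - x) \<le> \<gamma> * norm (z - x)" if "z \<in> \<Omega>" "norm (z - x) < min r r'" for z
      using r(2)[of z] r'(2)[of z] that by (simp add: blinfun.add_left)
    then show "\<exists>\<rho>>0. \<forall>z\<in>\<Omega>. norm (z - x) < \<rho> \<longrightarrow> (f + f') (z - x) \<le> \<gamma> * norm (z - x)"
      using r(1) r'(1) by (intro exI[of _ "min r r'"]) auto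
  qed
next
  fix f and c :: real assume f: "f \<in> frechet_normal_cone x \<Omega>" and c: "0 \<le> c"
  show "c *\<^sub>R f \<in> frechet_normal_cone x \<Omega>"
    unfolding frechet_normal_cone_iff[OF x]
  proof (intro allI impI)
    fix \<gamma> :: real assume \<gamma>: "\<gamma> > 0"
    then have "\<gamma> / (c + 1) > 0" using c by simp
    then obtain r where r: "r > 0" "\<And>z. z \<in> \<Omega> \<Longrightarrow> norm (z - x) < r \<Longrightarrow> f (z - x) \<le> \<gamma> / (c + 1) * norm (z - x)"
      using f[unfolded frechet_normal_cone_iff[OF x]] by metis
    have "(c *\<^sub>R f) (z - x) \<le> \<gamma> * norm (z - x)" if z: "z \<in> \<Omega>" "norm (z - x) < r" for z
    proof -
      have "c * f (z - x) \<le> c * (\<gamma> / (c + 1) * norm (z - x))" using r(2)[OF z] c by (intro mult_left_mono)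
      also have "\<dots> = (c / (c + 1)) * (\<gamma> * norm (z - x))" by simp
      also have "\<dots> \<le> 1 * (\<gamma> * norm (z - x))" using c \<gamma> by (intro mult_right_mono) auto
      finally show ?thesis by (simp add: blinfun.scaleR_left)
    qed
    then show "\<exists>\<rho>>0. \<forall>z\<in>\<Omega>. norm (z - x) < \<rho> \<longrightarrow> (c *\<^sub>R f) (z - x) \<le> \<gamma> * norm (z - x)"
      using r(1) by blast
  qed
qed

lemma limitin_weak_star_imp_tendsto:
  assumes "limitin weak_star_topology f l F"
  shows "((\<lambda>n. blinfun_apply (f n) v) \<longlongrightarrow> blinfun_apply l v) F"
  using continuous_map_limit[OF strong_operator_topology_continuous_evaluation assms, of v]
  by (simp add: o_def)


lemma frechet_normal_cone_subset_limiting: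
  assumes x: "x \<in> \<Omega>"
  shows "frechet_normal_cone x \<Omega> \<subseteq> limiting_normal_cone x \<Omega>"
proof
  fix f assume f: "f \<in> frechet_normal_cone x \<Omega>"
  then show "f \<in> limiting_normal_cone x \<Omega>"
    unfolding limiting_normal_cone_def limiting_subdiff_def mem_Collect_eq
    by (intro exI[of _ "\<lambda>n. x"] exI[of _ "\<lambda>n. 0"] exI[of _ "\<lambda>n. f"])
       (auto simp: frechet_normal_cone_def frechet_subdiff_def limitin_def strong_operator_topology_topspace)
qed

lemma strict_derivative_Lipschitz:
  assumes h: "has_strict_derivative h A x" and "\<kappa> > 0"
  obtains r where "r > 0"
    "\<And>u v. u \<in> cball x r \<Longrightarrow> v \<in> cball x r \<Longrightarrow> norm (h u - h v - A (u - v)) \<le> \<kappa> * norm (u - v)"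
proof -
  have "\<forall>\<^sub>F w in at (x, x) within {(u, v). u \<noteq> v}.
      dist ((\<lambda>(u, v). (h u - h v - A (u - v)) /\<^sub>R norm (u - v)) w) 0 < \<kappa>"
    using h assms(2) unfolding has_strict_derivative_def by (rule tendstoD)
  then obtain r where r: "r > 0" and
    rr: "\<And>u v. u \<noteq> v \<Longrightarrow> (u, v) \<noteq> (x, x) \<Longrightarrow> dist (u, v) (x, x) < r \<Longrightarrow>
        norm ((h u - h v - A (u - v)) /\<^sub>R norm (u - v)) < \<kappa>"
    by (auto simp: eventually_at)
  have "norm (h u - h v - A (u - v)) \<le> \<kappa> * norm (u - v)"
    if u: "u \<in> cball x (r / 3)" and v: "v \<in> cball x (r / 3)" for u v
  proof (cases "u = v")
    case False
    have "dist (u, v) (x, x) \<le> dist u x + dist v x"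
      unfolding dist_Pair_Pair by (rule sqrt_sum_squares_le_sum) auto
    also have "\<dots> < r" using u v r by (simp add: dist_commute)
    finally have "norm ((h u - h v - A (u - v)) /\<^sub>R norm (u - v)) < \<kappa>"
      using False by (intro rr) auto
    then have "norm (h u - h v - A (u - v)) / norm (u - v) < \<kappa>"
      by (simp only: norm_scaleR abs_inverse abs_norm_cancel divide_inverse mult.commute)
    then show ?thesis using False by (simp add: pos_divide_less_eq)
  qed (use assms(2) in \<open>auto simp: blinfun.bilinear_simps\<close>)
  then show ?thesis using that[of "r / 3"] r by auto
qed

text \<open>
  A finite bound on the difference quotient rules out the value \<open>\<infinity>\<close>; the moduli thus carry the
  information that the functions are finite near the reference point.
\<close>

lemma ereal_quotient_estimate:
  assumes "\<bar>y - ereal a - ereal b\<bar> / ereal n < ereal \<gamma>" "n > 0"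
  shows "\<exists>v. y = ereal v \<and> \<bar>v - a - b\<bar> \<le> \<gamma> * n"
  using assms by (cases y) (auto simp: field_simps)

lemma frechet_modulus_estimate:
  assumes unif: "uniformly_frechet_diff T g G xb" and fin: "\<And>t. t \<in> T \<Longrightarrow> \<bar>g t xb\<bar> \<noteq> \<infinity>"
    and \<gamma>: "\<gamma> > 0"
  obtains \<eta> where "\<eta> > 0"
    "\<And>t x. t \<in> T \<Longrightarrow> x \<in> cball xb \<eta> \<Longrightarrow>
       \<exists>v. g t x = ereal v \<and> \<bar>v - real_of_ereal (g t xb) - G t (x - xb)\<bar> \<le> \<gamma> * norm (x - xb)"
proof -
  have "\<forall>\<^sub>F \<eta> in at_right 0. frechet_modulus T g G xb \<eta> < ereal \<gamma>"
    using unif \<gamma> unfolding uniformly_frechet_diff_def by (intro order_tendstoD) auto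
  then obtain \<eta> where \<eta>: "\<eta> > 0" "frechet_modulus T g G xb \<eta> < ereal \<gamma>"
    unfolding eventually_at_right_field by (metis dense)
  have "\<exists>v. g t x = ereal v \<and> \<bar>v - real_of_ereal (g t xb) - G t (x - xb)\<bar> \<le> \<gamma> * norm (x - xb)"
    if t: "t \<in> T" and x: "x \<in> cball xb \<eta>" for t x
  proof (cases "x = xb")
    case True
    then show ?thesis using fin[OF t] by (intro exI[of _ "real_of_ereal (g t xb)"]) (auto simp: ereal_real')
  next
    case False
    have "\<bar>g t x - g t xb - ereal (G t (x - xb))\<bar> / ereal (norm (x - xb)) \<le>
        (SUP x\<in>cball xb \<eta> - {xb}. \<bar>g t x - g t xb - ereal (G t (x - xb))\<bar> / ereal (norm (x - xb)))"
      using False x by (intro SUP_upper) auto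
    also have "\<dots> \<le> (SUP t\<in>T. SUP x\<in>cball xb \<eta> - {xb}. \<bar>g t x - g t xb - ereal (G t (x - xb))\<bar> / ereal (norm (x - xb)))"
      using t by (rule SUP_upper)
    also have "\<dots> < ereal \<gamma>" using \<eta>(2) by (simp add: frechet_modulus_def)
    finally have "\<bar>g t x - ereal (real_of_ereal (g t xb)) - ereal (G t (x - xb))\<bar> / ereal (norm (x - xb)) < ereal \<gamma>"
      using fin[OF t] by (simp add: ereal_real')
    then show ?thesis by (rule ereal_quotient_estimate) (use False in auto)
  qed
  then show ?thesis using that \<eta>(1) by blast
qed

lemma strict_modulus_estimate:
  assumes unif: "uniformly_strictly_diff T g G xb" and \<gamma>: "\<gamma> > 0"
  obtains \<eta> where "\<eta> > 0"
    "\<And>t x x'. t \<in> T \<Longrightarrow> x \<in> cball xb \<eta> \<Longrightarrow> x' \<in> cball xb \<eta> \<Longrightarrow> \<bar>g t x'\<bar> \<noteq> \<infinity> \<Longrightarrow>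
       \<exists>v. g t x = ereal v \<and> \<bar>v - real_of_ereal (g t x') - G t (x - x')\<bar> \<le> \<gamma> * norm (x - x')"
proof -
  have "\<forall>\<^sub>F \<eta> in at_right 0. strict_modulus T g G xb \<eta> < ereal \<gamma>"
    using unif \<gamma> unfolding uniformly_strictly_diff_def by (intro order_tendstoD) auto
  then obtain \<eta> where \<eta>: "\<eta> > 0" "strict_modulus T g G xb \<eta> < ereal \<gamma>"
    unfolding eventually_at_right_field by (metis dense)
  have "\<exists>v. g t x = ereal v \<and> \<bar>v - real_of_ereal (g t x') - G t (x - x')\<bar> \<le> \<gamma> * norm (x - x')"
    if t: "t \<in> T" and x: "x \<in> cball xb \<eta>" and x': "x' \<in> cball xb \<eta>" and fin: "\<bar>g t x'\<bar> \<noteq> \<infinity>" for t x x'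
  proof (cases "x = x'")
    case True
    then show ?thesis using fin by (intro exI[of _ "real_of_ereal (g t x')"]) (auto simp: ereal_real')
  next
    case False
    let ?P = "{(x, x'). x \<in> cball xb \<eta> \<and> x' \<in> cball xb \<eta> \<and> x \<noteq> x'}"
    let ?q = "\<lambda>t (x, x'). \<bar>g t x - g t x' - ereal (G t (x - x'))\<bar> / ereal (norm (x - x'))"
    have "?q t (x, x') \<le> (SUP w\<in>?P. ?q t w)"
      using False x x' by (intro SUP_upper) auto
    also have "\<dots> \<le> (SUP t\<in>T. SUP w\<in>?P. ?q t w)"
      using t by (rule SUP_upper)
    also have "\<dots> < ereal \<gamma>" using \<eta>(2) by (simp add: strict_modulus_def)
    finally have "\<bar>g t x - ereal (real_of_ereal (g t x')) - ereal (G t (x - x'))\<bar> / ereal (norm (x - x')) < ereal \<gamma>"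
      using fin by (simp add: ereal_real')
    then show ?thesis by (rule ereal_quotient_estimate) (use False in auto)
  qed
  then show ?thesis using that \<eta>(1) by blast
qed

section \<open>Normals are nonpositive on the linearized system\<close>

text \<open>
  A step in a direction of the kernel of \<open>H\<close> violates \<open>h = 0\<close> only by a small multiple of its length,
  by strict differentiability, so the Newton iteration repairs it at a cost \<open>\<zeta> * s\<close>.  The point of the
  formulation is that the radius \<open>r\<close> works for all base points near \<open>xb\<close> at once, as needed when
  the base points converge to \<open>xb\<close>.
\<close>

lemma feasible_point_near_tangent_step:
  fixes h :: "'a::banach \<Rightarrow> 'b::banach" and H :: "'a \<Rightarrow>\<^sub>L 'b"
  assumes h_diff: "has_strict_derivative h H xb" and surj: "surj H" and w: "H w = 0" and \<zeta>: "\<zeta> > 0"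
  obtains r where "r > 0"
    "\<And>x s. x \<in> cball xb r \<Longrightarrow> h x = 0 \<Longrightarrow> 0 < s \<Longrightarrow> s * (norm w + 1) \<le> r \<Longrightarrow>
       \<exists>z. h z = 0 \<and> norm (z - (x + s *\<^sub>R w)) \<le> \<zeta> * s"
proof -
  obtain c where c: "c > 0" and inv: "\<And>y. \<exists>x. norm x \<le> c * norm y \<and> norm (y - H x) \<le> norm y / 4"
    using surj_approx_right_inverse[OF surj] by metis
  define V where "V = norm w + 1"
  have V: "V \<ge> 1" "norm w \<le> V" by (auto simp: V_def)
  \<comment> \<open>The first bound makes the iteration contract, the second makes the correction at most \<open>\<zeta> * s\<close>.\<close>
  define \<kappa> where "\<kappa> = min (1 / (4 * c)) (\<zeta> / (2 * c * V))"
  have \<kappa>: "\<kappa> > 0" "\<kappa> \<le> 1 / (4 * c)" "\<kappa> \<le> \<zeta> / (2 * c * V)"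
    using c \<zeta> V by (auto simp: \<kappa>_def)
  obtain r where r: "r > 0" and
    lip: "\<And>u v. u \<in> cball xb r \<Longrightarrow> v \<in> cball xb r \<Longrightarrow> norm (h u - h v - H (u - v)) \<le> \<kappa> * norm (u - v)"
    using strict_derivative_Lipschitz[OF h_diff \<kappa>(1)] by blast
  have "\<exists>z. h z = 0 \<and> norm (z - (x + s *\<^sub>R w)) \<le> \<zeta> * s"
    if x: "x \<in> cball xb (r / 4)" and hx: "h x = 0" and s: "0 < s" and sV: "s * V \<le> r / 4" for x s
  proof -
    define x0 where "x0 = x + s *\<^sub>R w"
    have sw: "norm (s *\<^sub>R w) \<le> s * V" using s V by (simp add: mult_left_mono)
    have nx0: "dist xb x0 \<le> r / 2"
    proof -
      have "dist xb x0 \<le> dist xb x + dist x x0" by (rule dist_triangle)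
      also have "dist x x0 = norm (s *\<^sub>R w)" by (simp add: x0_def dist_norm)
      finally show ?thesis using x sw sV by simp
    qed
    have "norm (h x0 - h x - H (x0 - x)) \<le> \<kappa> * norm (x0 - x)"
      using nx0 x r by (intro lip) auto
    then have hx0: "norm (h x0) \<le> \<kappa> * norm (s *\<^sub>R w)"
      using hx w by (simp add: x0_def blinfun.scaleR_right)
    also have "\<dots> \<le> \<kappa> * (s * V)" using sw \<kappa> by (intro mult_left_mono) auto
    finally have hx0: "norm (h x0) \<le> \<kappa> * (s * V)" .
    have "2 * c * norm (h x0) \<le> 2 * c * (1 / (4 * c) * (r / 4))"
    proof -
      have "\<kappa> * (s * V) \<le> 1 / (4 * c) * (r / 4)" using \<kappa> c sV s V by (intro mult_mono) auto
      with hx0 show ?thesis using c by (intro mult_left_mono) auto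
    qed
    also have "\<dots> \<le> r / 2" using c r by (simp add: field_simps)
    finally have small: "2 * c * norm (h x0) \<le> r / 2" .
    have "2 * c * norm (h x0) \<le> 2 * c * (\<zeta> / (2 * c * V) * (s * V))"
    proof -
      have "\<kappa> * (s * V) \<le> \<zeta> / (2 * c * V) * (s * V)" using \<kappa> s V by (intro mult_right_mono) auto
      with hx0 show ?thesis using c by (intro mult_left_mono) auto
    qed
    also have "\<dots> = \<zeta> * s" using c V by (simp add: field_simps)
    finally have close: "2 * c * norm (h x0) \<le> \<zeta> * s" .
    have "norm (h u - h v - H (u - v)) \<le> norm (u - v) / (4 * c)"
      if u: "u \<in> cball x0 (r / 2)" and v: "v \<in> cball x0 (r / 2)" for u v
    proof -
      have "norm (h u - h v - H (u - v)) \<le> \<kappa> * norm (u - v)"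
        using u v nx0 dist_triangle[of xb u x0] dist_triangle[of xb v x0] by (intro lip) auto
      also have "\<dots> \<le> 1 / (4 * c) * norm (u - v)" using \<kappa> by (intro mult_right_mono) auto
      finally show ?thesis by simp
    qed
    then obtain z where "norm (z - x0) \<le> 2 * c * norm (h x0)" "h z = 0"
      using Lyusternik_Graves[OF c inv, of x0 "r / 2" h] small by blast
    then show ?thesis using close by (auto simp: x0_def)
  qed
  then show ?thesis using that[of "r / 4"] r by (simp add: V_def)
qed

text \<open>
  Why a limit \<open>f'\<close> of \<open>e n\<close>-normals \<open>f n\<close> at feasible \<open>x n\<close> respects the linearized inequalities.
  Perturb \<open>u\<close> to \<open>w = u + \<eta> d\<close>, so that the nearly active inequalities hold with a margin \<open>\<eta> * \<delta>\<close>, and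
  step from \<open>x n\<close> to \<open>x n + s w\<close>, corrected by at most \<open>\<zeta> * s\<close> to satisfy \<open>h = 0\<close>.  For small \<open>s\<close>
  the resulting point is feasible: the margin absorbs all errors at the nearly active indices, and at the
  others \<open>g t (x n)\<close> is uniformly negative.  So \<open>f n\<close> is at most of order \<open>\<zeta>\<close> on \<open>w\<close>; here the
  correction is controlled because the \<open>f n\<close> are bounded.  Let \<open>n\<close> go to infinity, then \<open>\<zeta>\<close> and
  \<open>\<eta>\<close> to zero.

  The one-sided expansion of the \<open>g t\<close> at the moving points \<open>x n\<close> is kept as a hypothesis.  It
  follows from uniform strict differentiability in general, and from uniform Frechet differentiability if
  \<open>x n = xb\<close> for all \<open>n\<close>; this is how one lemma serves both normal cones.
\<close>

lemma limit_of_normals_nonpos: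
  fixes T :: "'i set" and g :: "'i \<Rightarrow> 'a::banach \<Rightarrow> ereal" and h :: "'a \<Rightarrow> 'b::banach"
    and G :: "'i \<Rightarrow> 'a \<Rightarrow>\<^sub>L real" and H :: "'a \<Rightarrow>\<^sub>L 'b" and f :: "nat \<Rightarrow> 'a \<Rightarrow>\<^sub>L real"
    and xb d u :: 'a and M \<epsilon>' \<delta> :: real
  defines "\<Omega> \<equiv> feasible_set T g h"
  assumes proper: "\<And>t x. t \<in> T \<Longrightarrow> g t x \<noteq> -\<infinity>" and feasible: "xb \<in> \<Omega>"
    and M: "\<And>t. t \<in> T \<Longrightarrow> norm (G t) \<le> M"
    and h_diff: "has_strict_derivative h H xb" and surj: "surj H"
    and g_unif: "uniformly_frechet_diff T g G xb"
    and d: "H d = 0" and eps0: "\<epsilon>' > 0" and del: "\<delta> > 0"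
    and slater: "\<And>t. t \<in> T \<Longrightarrow> real_of_ereal (g t xb) \<ge> - \<epsilon>' \<Longrightarrow> G t d \<le> - \<delta>"
    and x: "x \<longlonglongrightarrow> xb" "\<And>n. x n \<in> \<Omega>"
    and e: "e \<longlonglongrightarrow> 0"
    and f: "\<And>n. f n \<in> frechet_subdiff_eps (e n) (indicator_ereal \<Omega>) (x n)"
    and f_lim: "\<And>v. (\<lambda>n. f n v) \<longlonglongrightarrow> blinfun_apply f' v"
    and upper: "\<And>\<gamma>. \<gamma> > 0 \<Longrightarrow> \<exists>\<rho>>0. \<forall>\<^sub>F n in sequentially. \<forall>t\<in>T. \<forall>z\<in>cball (x n) \<rho>.
         g t z \<le> ereal (real_of_ereal (g t (x n)) + G t (z - x n) + \<gamma> * norm (z - x n))"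
    and u: "H u = 0" "\<And>t. t \<in> T \<Longrightarrow> G t u + real_of_ereal (g t xb) \<le> 0"
  shows "f' u \<le> 0"
proof -
  define c where "c t = real_of_ereal (g t xb)" for t
  define a where "a n t = real_of_ereal (g t (x n))" for n t
  have feas_fin: "\<bar>g t z\<bar> \<noteq> \<infinity>" if "z \<in> \<Omega>" "t \<in> T" for t z
  proof -
    have "g t z \<le> 0" using that by (auto simp: \<Omega>_def feasible_set_def)
    then show ?thesis using proper[OF that(2), of z] by auto
  qed
  have feas_nonpos: "real_of_ereal (g t z) \<le> 0" if "z \<in> \<Omega>" "t \<in> T" for t z
    using that by (auto simp: \<Omega>_def feasible_set_def real_of_ereal_le_0)
  have a0: "a n t \<le> 0" if "t \<in> T" for n t
    using feas_nonpos[OF x(2) that] by (simp add: a_def)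
  define Md where "Md = \<bar>M\<bar>"
  have Md: "norm (G t) \<le> Md" if "t \<in> T" for t using M[OF that] by (simp add: Md_def)
  have Md0: "Md \<ge> 0" by (simp add: Md_def)
  have G_le: "G t v \<le> Md * norm v" if "t \<in> T" for t v
  proof -
    have "G t v \<le> norm (G t) * norm v" using norm_blinfun[of "G t" v] by simp
    also have "\<dots> \<le> Md * norm v" using Md[OF that] by (intro mult_right_mono) auto
    finally show ?thesis .
  qed
  have "bounded (range (\<lambda>n. f n v))" for v
    using f_lim[of v] convergentI convergent_imp_bounded by blast
  then obtain W where W: "\<And>n. norm (f n) \<le> W"
    using uniform_boundedness_sequence by blast
  then have W0: "W \<ge> 0" using norm_ge_zero order_trans by blast
  have main: "f' (u + \<eta> *\<^sub>R d) \<le> 0" if \<eta>: "\<eta> > 0" for \<eta> :: real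
  proof -
    define w where "w = u + \<eta> *\<^sub>R d"
    define V where "V = norm w + 1"
    have V: "V \<ge> 1" "norm w \<le> V" by (auto simp: V_def)
    have Hw: "H w = 0" using u d by (simp add: w_def blinfun.add_right blinfun.scaleR_right)
    \<comment> \<open>The second bound fits all errors into the margin \<open>\<eta> * \<delta>\<close>; the third keeps the indices outside the
      \<open>\<epsilon>'\<close>-active ones below \<open>- \<epsilon>' / 2\<close> at \<open>x n\<close>.\<close>
    define \<zeta>0 where "\<zeta>0 = min 1 (min (\<eta> * \<delta> / (Md + V + 1)) (\<epsilon>' / 2))"
    have \<zeta>0: "\<zeta>0 > 0" using \<eta> del Md0 V eps0 by (simp add: \<zeta>0_def)
    have est: "f' w \<le> (2 * V + W) * \<zeta>" if \<zeta>: "0 < \<zeta>" "\<zeta> \<le> \<zeta>0" for \<zeta>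
    proof -
      have \<zeta>': "\<zeta> \<le> 1" "\<zeta> * (Md + V + 1) \<le> \<eta> * \<delta>" "\<zeta> \<le> \<epsilon>' / 2"
        using \<zeta> V Md0 by (auto simp: \<zeta>0_def pos_le_divide_eq)
      obtain r where r: "r > 0" and
        corr: "\<And>y s. y \<in> cball xb r \<Longrightarrow> h y = 0 \<Longrightarrow> 0 < s \<Longrightarrow> s * V \<le> r \<Longrightarrow>
           \<exists>z. h z = 0 \<and> norm (z - (y + s *\<^sub>R w)) \<le> \<zeta> * s"
        using feasible_point_near_tangent_step[OF h_diff surj Hw \<zeta>(1)] unfolding V_def by blast
      obtain \<rho> where \<rho>: "\<rho> > 0" and up: "\<forall>\<^sub>F n in sequentially. \<forall>t\<in>T. \<forall>z\<in>cball (x n) \<rho>.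
           g t z \<le> ereal (real_of_ereal (g t (x n)) + G t (z - x n) + \<zeta> * norm (z - x n))"
        using upper[OF \<zeta>(1)] by blast
      obtain \<eta>1 where \<eta>1: "\<eta>1 > 0" and fr: "\<And>t y. t \<in> T \<Longrightarrow> y \<in> cball xb \<eta>1 \<Longrightarrow>
           \<exists>v. g t y = ereal v \<and> \<bar>v - real_of_ereal (g t xb) - G t (y - xb)\<bar> \<le> 1 * norm (y - xb)"
        using frechet_modulus_estimate[OF g_unif feas_fin[OF feasible], of 1] by (metis zero_less_one)
      have near: "\<forall>\<^sub>F n in sequentially. dist (x n) xb < min (min r \<eta>1) (\<zeta> / (Md + 1))"
        using r \<eta>1 \<zeta> Md0 by (intro tendstoD[OF x(1)]) auto
      have esmall: "\<forall>\<^sub>F n in sequentially. e n < \<zeta>"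
        using e \<zeta>(1) by (rule order_tendstoD)
      have "\<forall>\<^sub>F n in sequentially. f n w \<le> (2 * V + W) * \<zeta>"
        using up near esmall
      proof eventually_elim
        case (elim n)
        have up: "g t z \<le> ereal (a n t + G t (z - x n) + \<zeta> * norm (z - x n))"
          if "t \<in> T" "z \<in> cball (x n) \<rho>" for t z
          using elim(1) that by (simp add: a_def)
        have xr: "x n \<in> cball xb r" "x n \<in> cball xb \<eta>1" "norm (x n - xb) \<le> \<zeta> / (Md + 1)"
          using elim(2) by (auto simp: dist_commute) (simp add: dist_norm norm_minus_commute)
        have hx: "h (x n) = 0" using x(2)[of n] by (simp add: \<Omega>_def feasible_set_def)
        have ac: "a n t \<le> c t + \<zeta>" if t: "t \<in> T" for t
        proof -
          obtain v where v: "g t (x n) = ereal v"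
              "\<bar>v - real_of_ereal (g t xb) - G t (x n - xb)\<bar> \<le> 1 * norm (x n - xb)"
            using fr[OF t xr(2)] by blast
          then have "a n t \<le> c t + G t (x n - xb) + norm (x n - xb)"
            by (simp add: a_def c_def)
          also have "\<dots> \<le> c t + (Md + 1) * norm (x n - xb)"
            using G_le[OF t, of "x n - xb"] by (simp add: algebra_simps)
          also have "(Md + 1) * norm (x n - xb) \<le> (Md + 1) * (\<zeta> / (Md + 1))"
            using xr(3) Md0 by (intro mult_left_mono) auto
          also have "\<dots> = \<zeta>" using Md0 by simp
          finally show ?thesis by simp
        qed
        obtain \<rho>n where \<rho>n: "\<rho>n > 0" "\<And>z. z \<in> \<Omega> \<Longrightarrow> norm (z - x n) < \<rho>n \<Longrightarrow>
            f n (z - x n) \<le> (e n + \<zeta>) * norm (z - x n)"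
          using f[of n, unfolded frechet_subdiff_eps_indicator[OF x(2)]] \<zeta>(1) by metis
        \<comment> \<open>\<open>s * Q\<close> bounds the increase of any \<open>g t\<close> over the step, and \<open>Q \<ge> V \<ge> 1\<close> bounds the step itself, so one
          number \<open>m = s * Q\<close> can respect all smallness requirements.\<close>
        define Q where "Q = Md * V + Md + V"
        have Q: "Q \<ge> V" using Md0 V by (simp add: Q_def)
        define m where "m = min 1 (min r (min \<rho> (min (\<rho>n / 2) (\<epsilon>' / 2))))"
        have m: "m > 0" "m \<le> 1" "m \<le> r" "m \<le> \<rho>" "m < \<rho>n" "m \<le> \<epsilon>' / 2"
          using r \<rho> \<rho>n(1) eps0 by (auto simp: m_def)
        define s where "s = m / Q"
        have s: "s > 0" "s * Q = m" using m Q V by (auto simp: s_def)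
        have sV: "s * V \<le> m" using s Q mult_left_mono[of V Q s] by simp
        have "s * 1 \<le> s * V" using V s(1) by (intro mult_left_mono) auto
        then have s1: "s \<le> 1" using sV m by linarith
        obtain z where z: "h z = 0" "norm (z - (x n + s *\<^sub>R w)) \<le> \<zeta> * s"
          using corr[OF xr(1) hx s(1)] sV m by auto
        define q where "q = z - (x n + s *\<^sub>R w)"
        have zx: "z - x n = s *\<^sub>R w + q" by (simp add: q_def)
        have nq: "norm q \<le> s * \<zeta>" using z by (simp add: q_def mult.commute)
        have nzx: "norm (z - x n) \<le> s * V"
        proof -
          have "norm (z - x n) \<le> norm (s *\<^sub>R w) + norm q" unfolding zx by (rule norm_triangle_ineq)
          also have "\<dots> \<le> s * norm w + s * 1"
            using nq s(1) order_trans[OF nq mult_left_mono[OF \<zeta>'(1)]] by simp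
          finally show ?thesis by (simp add: V_def distrib_left)
        qed
        have zball: "z \<in> cball (x n) \<rho>"
          using nzx sV m by (simp add: dist_norm norm_minus_commute)
        have "g t z \<le> 0" if t: "t \<in> T" for t
        proof -
          have Gq: "G t q \<le> s * (Md * \<zeta>)"
          proof -
            have "G t q \<le> Md * norm q" by (rule G_le[OF t])
            also have "\<dots> \<le> Md * (s * \<zeta>)" using nq Md0 by (intro mult_left_mono)
            finally show ?thesis by (simp add: ac_simps)
          qed
          have \<zeta>n: "\<zeta> * norm (z - x n) \<le> s * (V * \<zeta>)"
            using nzx \<zeta>(1) mult_left_mono[of "norm (z - x n)" "s * V" \<zeta>] by (simp add: ac_simps)
          have "a n t + G t (z - x n) + \<zeta> * norm (z - x n) \<le> a n t + s * (G t w + (Md + V) * \<zeta>)"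
            using Gq \<zeta>n unfolding zx blinfun.add_right blinfun.scaleR_right
            by (simp add: algebra_simps)
          also have "\<dots> \<le> 0"
          proof (cases "c t \<ge> - \<epsilon>'")
            case True
            have Gw: "G t w + c t \<le> - (\<eta> * \<delta>)"
            proof -
              have "\<eta> * G t d \<le> \<eta> * (- \<delta>)"
                using slater[OF t] True \<eta> by (intro mult_left_mono) (auto simp: c_def)
              then show ?thesis
                using u(2)[OF t] by (simp add: w_def c_def blinfun.add_right blinfun.scaleR_right)
            qed
            \<comment> \<open>Since \<open>s \<le> 1\<close> and \<open>a n t \<le> 0\<close>, the value at \<open>x n\<close> may be scaled by \<open>s\<close> and joined with the increment,
              which is what brings in the inhomogeneous term of the linearized inequality.\<close>
            have "a n t \<le> s * a n t"
              using mult_right_mono_neg[OF s1 a0[OF t, of n]] by simp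
            also have "\<dots> \<le> s * (c t + \<zeta>)" using ac[OF t] s by (intro mult_left_mono) auto
            finally have "a n t + s * (G t w + (Md + V) * \<zeta>) \<le> s * (G t w + c t + \<zeta> * (Md + V + 1))"
              by (simp add: algebra_simps)
            also have "\<dots> \<le> 0"
              using Gw \<zeta>'(2) s by (intro mult_nonneg_nonpos) auto
            finally show ?thesis .
          next
            case False
            have "G t w \<le> Md * V"
              using order_trans[OF G_le[OF t, of w] mult_left_mono[OF V(2) Md0]] .
            moreover have "(Md + V) * \<zeta> \<le> Md + V"
              using mult_left_mono[OF \<zeta>'(1), of "Md + V"] Md0 V by simp
            ultimately have "s * (G t w + (Md + V) * \<zeta>) \<le> s * Q"
              using s by (intro mult_left_mono) (auto simp: Q_def)
            then show ?thesis using ac[OF t] False s m \<zeta>' by linarith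
          qed
          finally have "a n t + G t (z - x n) + \<zeta> * norm (z - x n) \<le> 0" .
          then have "ereal (a n t + G t (z - x n) + \<zeta> * norm (z - x n)) \<le> 0" by simp
          with up[OF t zball] show ?thesis by (rule order_trans)
        qed
        with z(1) have z\<Omega>: "z \<in> \<Omega>" by (simp add: \<Omega>_def feasible_set_def)
        have "f n (z - x n) \<le> (e n + \<zeta>) * norm (z - x n)"
          using \<rho>n(2)[OF z\<Omega>] nzx sV m by linarith
        also have "\<dots> \<le> (2 * \<zeta>) * norm (z - x n)" using elim(3) by (intro mult_right_mono) auto
        also have "\<dots> \<le> (2 * \<zeta>) * (s * V)" using nzx \<zeta> by (intro mult_left_mono) auto
        finally have 1: "f n (z - x n) \<le> s * (2 * V * \<zeta>)" by (simp add: ac_simps)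
        have "- f n q \<le> norm (f n) * norm q" using norm_blinfun[of "f n" q] by simp
        also have "\<dots> \<le> W * (s * \<zeta>)" using W nq W0 by (intro mult_mono) auto
        finally have "s * f n w \<le> s * ((2 * V + W) * \<zeta>)"
          using 1 unfolding zx by (simp add: blinfun.add_right blinfun.scaleR_right algebra_simps)
        then show ?case using s by simp
      qed
      then show ?thesis by (intro tendsto_upperbound[OF f_lim]) auto
    qed
    have "f' w \<le> 0"
    proof (rule field_le_epsilon)
      fix \<epsilon> :: real assume \<epsilon>: "\<epsilon> > 0"
      define \<zeta> where "\<zeta> = min \<zeta>0 (\<epsilon> / (2 * V + W))"
      have pos: "2 * V + W > 0" using V W0 by simp
      then have "0 < \<zeta>" "\<zeta> \<le> \<zeta>0" using \<zeta>0 \<epsilon> by (auto simp: \<zeta>_def)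
      then have "f' w \<le> (2 * V + W) * \<zeta>" by (rule est)
      also have "\<dots> \<le> (2 * V + W) * (\<epsilon> / (2 * V + W))"
        using pos by (intro mult_left_mono) (auto simp: \<zeta>_def)
      finally show "f' w \<le> 0 + \<epsilon>" using pos by simp
    qed
    then show ?thesis by (simp add: w_def)
  qed
  show ?thesis
  proof (rule field_le_epsilon)
    fix \<epsilon> :: real assume \<epsilon>: "\<epsilon> > 0"
    define \<eta> where "\<eta> = \<epsilon> / (\<bar>f' d\<bar> + 1)"
    have \<eta>: "\<eta> > 0" using \<epsilon> by (simp add: \<eta>_def)
    have "f' u \<le> \<eta> * (- f' d)"
      using main[OF \<eta>] by (simp add: blinfun.add_right blinfun.scaleR_right)
    also have "\<dots> \<le> \<eta> * (\<bar>f' d\<bar> + 1)" using \<eta> by (intro mult_left_mono) auto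
    also have "\<dots> = \<epsilon>" by (simp add: \<eta>_def add_nonneg_pos order_less_imp_not_eq2)
    finally show "f' u \<le> 0 + \<epsilon>" by simp
  qed
qed

section \<open>Multipliers give normals\<close>

text \<open>
  The Frechet normals form a convex cone, so the two kinds of generators can be treated separately.  At a
  feasible point the value of an active \<open>g t\<close> does not exceed its value \<open>0\<close> at \<open>xb\<close>, and \<open>h\<close> does
  not change at all; so on the displacement from \<open>xb\<close>, \<open>G t\<close> is nonpositive and \<open>H\<close> zero up to an error
  that is small relative to its length.
\<close>

lemma multiplier_cone_subset_frechet_normal_cone:
  fixes g :: "'i \<Rightarrow> 'a::real_normed_vector \<Rightarrow> ereal" and h :: "'a \<Rightarrow> 'b::real_normed_vector"
  assumes feasible: "xb \<in> feasible_set T g h" and proper: "\<And>t x. t \<in> T \<Longrightarrow> g t x \<noteq> -\<infinity>"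
    and h_diff: "has_strict_derivative h H xb"
    and g_unif: "uniformly_frechet_diff T g G xb"
  shows "cone_gen (G ` active T g xb) + range (dual_adjoint H) \<subseteq> frechet_normal_cone xb (feasible_set T g h)"
proof -
  let ?N = "frechet_normal_cone xb (feasible_set T g h)"
  note cc = convex_cone_frechet_normal_cone[OF feasible]
  have fin: "\<bar>g t xb\<bar> \<noteq> \<infinity>" if "t \<in> T" for t
  proof -
    have "g t xb \<le> 0" using that feasible by (auto simp: feasible_set_def)
    then show ?thesis using proper[OF that, of xb] by auto
  qed
  have "G t \<in> ?N" if t: "t \<in> active T g xb" for t
    unfolding frechet_normal_cone_iff[OF feasible]
  proof (intro allI impI)
    fix \<gamma> :: real assume "\<gamma> > 0"
    then obtain \<eta> where \<eta>: "\<eta> > 0" and fr: "\<And>t y. t \<in> T \<Longrightarrow> y \<in> cball xb \<eta> \<Longrightarrow>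
           \<exists>v. g t y = ereal v \<and> \<bar>v - real_of_ereal (g t xb) - G t (y - xb)\<bar> \<le> \<gamma> * norm (y - xb)"
      using frechet_modulus_estimate[OF g_unif fin] by metis
    have tT: "t \<in> T" "g t xb = 0" using t by (auto simp: active_def)
    have "G t (z - xb) \<le> \<gamma> * norm (z - xb)"
      if z: "z \<in> feasible_set T g h" "norm (z - xb) < \<eta>" for z
    proof -
      obtain v where "g t z = ereal v" "\<bar>v - 0 - G t (z - xb)\<bar> \<le> \<gamma> * norm (z - xb)"
        using fr[OF tT(1), of z] z(2) tT(2) by (auto simp: dist_norm norm_minus_commute)
      moreover have "g t z \<le> 0" using z(1) tT(1) by (auto simp: feasible_set_def)
      ultimately show ?thesis by auto
    qed
    with \<eta> show "\<exists>\<rho>>0. \<forall>z\<in>feasible_set T g h. norm (z - xb) < \<rho> \<longrightarrow> G t (z - xb) \<le> \<gamma> * norm (z - xb)"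
      by blast
  qed
  then have 1: "cone_gen (G ` active T g xb) \<subseteq> ?N"
    by (intro cone_gen_minimal[OF cc]) auto
  have "dual_adjoint H y \<in> ?N" for y
    unfolding frechet_normal_cone_iff[OF feasible]
  proof (intro allI impI)
    fix \<gamma> :: real assume \<gamma>: "\<gamma> > 0"
    then have "\<gamma> / (norm y + 1) > 0" by (simp add: add_nonneg_pos)
    then obtain r where r: "r > 0" and lip: "\<And>u v. u \<in> cball xb r \<Longrightarrow> v \<in> cball xb r \<Longrightarrow>
        norm (h u - h v - H (u - v)) \<le> \<gamma> / (norm y + 1) * norm (u - v)"
      using strict_derivative_Lipschitz[OF h_diff] by blast
    have "dual_adjoint H y (z - xb) \<le> \<gamma> * norm (z - xb)"
      if z: "z \<in> feasible_set T g h" "norm (z - xb) < r" for z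
    proof -
      have "norm (h z - h xb - H (z - xb)) \<le> \<gamma> / (norm y + 1) * norm (z - xb)"
        using z r by (intro lip) (auto simp: dist_norm norm_minus_commute)
      then have Hz: "norm (H (z - xb)) \<le> \<gamma> / (norm y + 1) * norm (z - xb)"
        using z feasible by (simp add: feasible_set_def)
      have "dual_adjoint H y (z - xb) \<le> norm y * norm (H (z - xb))"
        using norm_blinfun[of y "H (z - xb)"] by (simp add: dual_adjoint_def)
      also have "\<dots> \<le> norm y * (\<gamma> / (norm y + 1) * norm (z - xb))"
        using Hz by (intro mult_left_mono) auto
      also have "\<dots> = (norm y / (norm y + 1)) * (\<gamma> * norm (z - xb))" by simp
      also have "\<dots> \<le> 1 * (\<gamma> * norm (z - xb))"
        using \<gamma> by (intro mult_right_mono) (auto simp: divide_le_eq add_nonneg_pos)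
      finally show ?thesis by simp
    qed
    with r show "\<exists>\<rho>>0. \<forall>z\<in>feasible_set T g h. norm (z - xb) < \<rho> \<longrightarrow> dual_adjoint H y (z - xb) \<le> \<gamma> * norm (z - xb)"
      by blast
  qed
  with 1 show ?thesis
    using convex_cone_add[OF cc] by (fastforce simp: set_plus_def)
qed

section \<open>The normal cones of the feasible set\<close>

theorem theorem4p7:
  fixes T :: "'i set"
    and g :: "'i \<Rightarrow> 'a::banach \<Rightarrow> ereal"
    and h :: "'a \<Rightarrow> 'b::banach"
    and G :: "'i \<Rightarrow> 'a \<Rightarrow>\<^sub>L real"
    and H :: "'a \<Rightarrow>\<^sub>L 'b"
    and xb :: 'a
  assumes g_proper: "\<And>t x. t \<in> T \<Longrightarrow> g t x \<noteq> -\<infinity>"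
    and feasible: "xb \<in> feasible_set T g h"
    and g_diff: "\<And>t. t \<in> T \<Longrightarrow> has_frechet_derivative_ereal (g t) (G t) xb"
    and G_bounded: "bounded (G ` T)"
    and h_diff: "has_strict_derivative h H xb"
    and g_unif: "uniformly_frechet_diff T g G xb"
    and pmfcq: "PMFCQ T g G H xb"
    and nfmcq: "NFMCQ T g G xb"
  shows "frechet_normal_cone xb (feasible_set T g h)
           = cone_gen (G ` active T g xb) + range (dual_adjoint H)
       \<and> (uniformly_strictly_diff T g G xb \<longrightarrow>
            limiting_normal_cone xb (feasible_set T g h)
              = cone_gen (G ` active T g xb) + range (dual_adjoint H))"
proof -
  let ?\<Omega> = "feasible_set T g h"
  let ?S = "cone_gen (G ` active T g xb) + range (dual_adjoint H)"
  define c where "c t = real_of_ereal (g t xb)" for t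
  have fin: "\<bar>g t z\<bar> \<noteq> \<infinity>" if "t \<in> T" "z \<in> ?\<Omega>" for t z
  proof -
    have "g t z \<le> 0" using that by (auto simp: feasible_set_def)
    then show ?thesis using g_proper[OF that(1), of z] by auto
  qed
  have gc: "g t xb = ereal (c t)" if "t \<in> T" for t
    using fin[OF that feasible] by (simp add: c_def ereal_real')
  have c0: "c t \<le> 0" if "t \<in> T" for t
    using that feasible gc[OF that] by (auto simp: feasible_set_def)
  have active: "active T g xb = {t \<in> T. c t = 0}"
    using gc by (auto simp: active_def)
  obtain M where M: "\<And>t. t \<in> T \<Longrightarrow> norm (G t) \<le> M"
    using G_bounded by (auto simp: bounded_iff)
  from pmfcq have surj: "surj H" by (simp add: PMFCQ_def)
  from pmfcq obtain d where d: "H d = 0"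
    and inf: "(INF \<epsilon>\<in>{0<..}. SUP t\<in>eps_active T g xb \<epsilon>. ereal (G t d)) < 0"
    by (auto simp: PMFCQ_def)
  from inf obtain \<epsilon> :: real where \<epsilon>: "\<epsilon> > 0" and sup: "(SUP t\<in>eps_active T g xb \<epsilon>. ereal (G t d)) < 0"
    unfolding INF_less_iff by auto
  obtain b where b: "(SUP t\<in>eps_active T g xb \<epsilon>. ereal (G t d)) < ereal b" "ereal b < 0"
    using ereal_dense2[OF sup] by blast
  have slater: "G t d \<le> - (- b)" if t: "t \<in> T" "c t \<ge> - \<epsilon>" for t
  proof -
    have "t \<in> eps_active T g xb \<epsilon>" using t gc[OF t(1)] by (simp add: eps_active_def)
    then have "ereal (G t d) < ereal b" by (rule SUP_lessD[OF b(1)])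
    then show ?thesis by simp
  qed
  have b0: "- b > 0" using b(2) by simp
  \<comment> \<open>The duality half: the Farkas lemma on the kernel of \<open>H\<close> gives the inequality multipliers, and what is left
    of \<open>f\<close> vanishes on that kernel.\<close>
  have multipliers: "f \<in> ?S"
    if nonpos: "\<And>u. H u = 0 \<Longrightarrow> (\<And>t. t \<in> T \<Longrightarrow> G t u + c t \<le> 0) \<Longrightarrow> f u \<le> 0"
    for f :: "'a \<Rightarrow>\<^sub>L real"
  proof -
    have "subspace {u. H u = 0}"
      by (auto simp: subspace_def blinfun.add_right blinfun.scaleR_right)
    then have "\<exists>k \<in> cone_gen (G ` {t \<in> T. c t = 0}). \<forall>u\<in>{u. H u = 0}. k u = f u"
      using nfmcq[unfolded NFMCQ_def, folded c_def] c0 M d \<epsilon> b0 slater nonpos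
      by (intro Farkas_closed_cone[of G xb c T M _ d \<epsilon> "- b"]) auto
    then obtain k where k: "k \<in> cone_gen (G ` active T g xb)" "\<And>u. H u = 0 \<Longrightarrow> k u = f u"
      unfolding active by blast
    have "f - k \<in> range (dual_adjoint H)"
      by (rule annihilator_kernel[OF surj]) (simp add: k blinfun.diff_left)
    then have "k + (f - k) \<in> ?S"
      by (rule set_plus_intro[OF k(1)])
    then show ?thesis by simp
  qed
  have lower: "?S \<subseteq> frechet_normal_cone xb ?\<Omega>"
    by (rule multiplier_cone_subset_frechet_normal_cone[OF feasible g_proper h_diff g_unif])
  have nonpos: "f' u \<le> 0"
    if "x \<longlonglongrightarrow> xb" "\<And>n. x n \<in> ?\<Omega>" "e \<longlonglongrightarrow> 0"
      "\<And>n. fn n \<in> frechet_subdiff_eps (e n) (indicator_ereal ?\<Omega>) (x n)"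
      "\<And>v. (\<lambda>n. fn n v) \<longlonglongrightarrow> blinfun_apply f' v"
      "\<And>\<gamma>. \<gamma> > 0 \<Longrightarrow> \<exists>\<rho>>0. \<forall>\<^sub>F n in sequentially. \<forall>t\<in>T. \<forall>z\<in>cball (x n) \<rho>.
         g t z \<le> ereal (real_of_ereal (g t (x n)) + G t (z - x n) + \<gamma> * norm (z - x n))"
      "H u = 0" "\<And>t. t \<in> T \<Longrightarrow> G t u + c t \<le> 0"
    for x e u and fn :: "nat \<Rightarrow> 'a \<Rightarrow>\<^sub>L real" and f'
    by (rule limit_of_normals_nonpos[where T = T and g = g and h = h and G = G and H = H and xb = xb
          and d = d and M = M and \<epsilon>' = \<epsilon> and \<delta> = "- b" and x = x and e = e and f = fn and u = u])
       (fact g_proper feasible M h_diff surj g_unif d \<epsilon> b0 slater[unfolded c_def] that[unfolded c_def])+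
  have upper: "frechet_normal_cone xb ?\<Omega> \<subseteq> ?S"
  proof
    fix f assume f: "f \<in> frechet_normal_cone xb ?\<Omega>"
    show "f \<in> ?S"
    proof (rule multipliers)
      fix u assume u: "H u = 0" "\<And>t. t \<in> T \<Longrightarrow> G t u + c t \<le> 0"
      show "f u \<le> 0"
      proof (rule nonpos[where x = "\<lambda>n. xb" and e = "\<lambda>n. 0" and fn = "\<lambda>n. f"])
        fix \<gamma> :: real assume "\<gamma> > 0"
        then obtain \<eta> where \<eta>: "\<eta> > 0" and fr: "\<And>t y. t \<in> T \<Longrightarrow> y \<in> cball xb \<eta> \<Longrightarrow>
           \<exists>v. g t y = ereal v \<and> \<bar>v - real_of_ereal (g t xb) - G t (y - xb)\<bar> \<le> \<gamma> * norm (y - xb)"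
          using frechet_modulus_estimate[OF g_unif fin[OF _ feasible]] by metis
        have "g t z \<le> ereal (real_of_ereal (g t xb) + G t (z - xb) + \<gamma> * norm (z - xb))"
          if "t \<in> T" "z \<in> cball xb \<eta>" for t z
          using fr[OF that] by auto
        with \<eta> show "\<exists>\<rho>>0. \<forall>\<^sub>F n in sequentially. \<forall>t\<in>T. \<forall>z\<in>cball xb \<rho>.
            g t z \<le> ereal (real_of_ereal (g t xb) + G t (z - xb) + \<gamma> * norm (z - xb))"
          by auto
      qed (use f u feasible in \<open>auto simp: frechet_normal_cone_def frechet_subdiff_def\<close>)
    qed
  qed
  have "limiting_normal_cone xb ?\<Omega> \<subseteq> ?S" if strict: "uniformly_strictly_diff T g G xb"
  proof
    fix f assume "f \<in> limiting_normal_cone xb ?\<Omega>"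
    then obtain x e fn where x: "x \<longlonglongrightarrow> xb" and e: "e \<longlonglongrightarrow> (0::real)"
      and fn: "\<And>n::nat. fn n \<in> frechet_subdiff_eps (e n) (indicator_ereal ?\<Omega>) (x n)"
      and lim: "limitin weak_star_topology fn f sequentially"
      unfolding limiting_normal_cone_def limiting_subdiff_def by blast
    have x\<Omega>: "x n \<in> ?\<Omega>" for n
      using fn[of n] by (auto simp: frechet_subdiff_eps_def indicator_ereal_def split: if_splits)
    show "f \<in> ?S"
    proof (rule multipliers)
      fix u assume u: "H u = 0" "\<And>t. t \<in> T \<Longrightarrow> G t u + c t \<le> 0"
      show "f u \<le> 0"
      proof (rule nonpos[where x = x and e = e and fn = fn])
        fix \<gamma> :: real assume "\<gamma> > 0"
        then obtain \<eta> where \<eta>: "\<eta> > 0" and st: "\<And>t y y'. t \<in> T \<Longrightarrow> y \<in> cball xb \<eta> \<Longrightarrow> y' \<in> cball xb \<eta> \<Longrightarrow> \<bar>g t y'\<bar> \<noteq> \<infinity> \<Longrightarrow>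
           \<exists>v. g t y = ereal v \<and> \<bar>v - real_of_ereal (g t y') - G t (y - y')\<bar> \<le> \<gamma> * norm (y - y')"
          using strict_modulus_estimate[OF strict] by metis
        have "\<forall>\<^sub>F n in sequentially. dist (x n) xb < \<eta> / 2"
          using \<eta> by (intro tendstoD[OF x]) simp
        then have "\<forall>\<^sub>F n in sequentially. \<forall>t\<in>T. \<forall>z\<in>cball (x n) (\<eta> / 2).
            g t z \<le> ereal (real_of_ereal (g t (x n)) + G t (z - x n) + \<gamma> * norm (z - x n))"
        proof eventually_elim
          case (elim n)
          have "g t z \<le> ereal (real_of_ereal (g t (x n)) + G t (z - x n) + \<gamma> * norm (z - x n))"
            if tz: "t \<in> T" "z \<in> cball (x n) (\<eta> / 2)" for t z
          proof -
            have "dist xb z \<le> dist xb (x n) + dist (x n) z" by (rule dist_triangle)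
            then have "z \<in> cball xb \<eta>" using elim tz(2) by (simp add: dist_commute)
            moreover have "x n \<in> cball xb \<eta>" using elim \<eta> by (simp add: dist_commute)
            ultimately show ?thesis using st[OF tz(1) _ _ fin[OF tz(1) x\<Omega>]] by force
          qed
          then show ?case by blast
        qed
        moreover have "\<eta> / 2 > 0" using \<eta> by simp
        ultimately show "\<exists>\<rho>>0. \<forall>\<^sub>F n in sequentially. \<forall>t\<in>T. \<forall>z\<in>cball (x n) \<rho>.
            g t z \<le> ereal (real_of_ereal (g t (x n)) + G t (z - x n) + \<gamma> * norm (z - x n))"
          by blast
      qed (fact x x\<Omega> e fn limitin_weak_star_imp_tendsto[OF lim] u)+
    qed
  qed
  with lower upper frechet_normal_cone_subset_limiting[OF feasible] show ?thesis by blast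
qed

end
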